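(* There is a positive constant $c>0$ such that for all integers $k \geq 4$ and $n>3k$: (1) $r_k(k + 3,n) \geq \mathrm{twr}_{k-1}(cn)$; (2) $r_k(k + 2,n) \geq \mathrm{twr}_{k - 1}(c\log^2 n)$; (3) $r_k(k + 1, n) \geq \mathrm{twr}_{k - 2}(cn^2)$.
   Context: For integers $k\ge 2$ and $s,n$, the Ramsey number $r_k(s,n)$ is the minimum $N$ such that every red-blue coloring of the $k$-element subsets of $[N]=\{1,\dots,N\}$ contains a red set of size $s$ or a blue set of size $n$, where a set is red (blue) if all of its $k$-subsets are red (blue); equivalently a red copy of the complete $k$-uniform hypergraph $K^{(k)}_s$ or a blue copy of $K^{(k)}_n$. The tower function is defined by $\mathrm{twr}_1(x)=x$ and $\mathrm{twr}_{i+1}(x)=2^{\mathrm{twr}_i(x)}$. *)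

theory Defs
  imports Complex_Main "HOL-Library.Ramsey"
begin

text \<open>In \<^term>\<open>ramsey_number k s n\<close>, red and blue are the colours \<open>0\<close> and \<open>1\<close> of \<^const>\<open>partn_lst\<close>.\<close>

definition ramsey_number :: "nat \<Rightarrow> nat \<Rightarrow> nat \<Rightarrow> nat"
  where "ramsey_number k s n = (LEAST N. partn_lst {1..N} [s, n] k)"

lemma partn_lst_inj_image:
  assumes "partn_lst A qs k" and inj: "inj_on g A" and sub: "g ` A \<subseteq> B"
  shows "partn_lst B qs k"
  unfolding partn_lst_def
proof
  fix f assume f: "f \<in> nsets B k \<rightarrow> {..<length qs}"
  have "f \<circ> (\<lambda>X. g ` X) \<in> nsets A k \<rightarrow> {..<length qs}"
    using f inj sub by (intro nsets_compose_image_funcset) auto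
  then obtain i H where i: "i < length qs" and H: "H \<in> nsets A (qs ! i)"
    and mono: "(f \<circ> (\<lambda>X. g ` X)) ` nsets H k \<subseteq> {i}"
    using assms(1) unfolding partn_lst_def monochromatic_def by blast
  have injH: "inj_on g H"
    using H inj by (auto simp: nsets_def intro: inj_on_subset)
  have "g ` H \<in> nsets B (qs ! i)"
    using H sub injH by (auto simp: nsets_def card_image)
  moreover have "f ` nsets (g ` H) k \<subseteq> {i}"
  proof clarify
    fix X assume "X \<in> nsets (g ` H) k"
    then obtain Y where "Y \<in> nsets H k" "X = g ` Y"
      using injH by (rule nset_image_obtains)
    then show "f X = i"
      using mono by auto
  qed
  ultimately show "\<exists>i<length qs. monochromatic B (qs ! i) k f i"
    using i unfolding monochromatic_def by blast
qed

text \<open>The minimum in the definition is taken over a nonempty set, so it is never a junk value.\<close>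

lemma partn_lst_ramsey_number: "partn_lst {1..ramsey_number k s n} [s, n] k"
proof -
  obtain N :: nat where N: "partn_lst {..<N} [s, n] k"
    using ramsey_full by blast
  have "partn_lst {1..N} [s, n] k"
    by (rule partn_lst_inj_image[OF N, of Suc]) auto
  then show ?thesis
    unfolding ramsey_number_def by (rule LeastI)
qed

lemma ramsey_number_le_iff: "ramsey_number k s n \<le> N \<longleftrightarrow> partn_lst {1..N} [s, n] k"
proof
  assume "ramsey_number k s n \<le> N"
  then show "partn_lst {1..N} [s, n] k"
    by (intro partn_lst_inj_image[OF partn_lst_ramsey_number, of id]) auto
next
  assume "partn_lst {1..N} [s, n] k"
  then show "ramsey_number k s n \<le> N"
    unfolding ramsey_number_def by (rule Least_le)
qed

text \<open>Towers start at index \<open>1\<close>; the value at index \<open>0\<close> is a dummy.\<close>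

fun twr :: "nat \<Rightarrow> real \<Rightarrow> real"
  where
    "twr 0 x = x"
  | "twr (Suc 0) x = x"
  | "twr (Suc (Suc i)) x = 2 powr twr (Suc i) x"

end

theory Submission
  imports Defs
begin

text \<open>
  A \<open>q\<close>-colouring of the triples without a monochromatic \<open>m\<close>-set gives a colouring of the quadruples: a
  quadruple is red iff the colour of its first triple is smaller than that of its last one. Red sets then
  have fewer than \<open>q + 3\<close> elements and blue sets fewer than \<open>q m\<close>. For \<open>q = 2\<close> the triples are coloured
  at random, for \<open>q = 3, 4\<close> by stepping up random graphs.

  From uniformity \<open>4\<close> on, colourings are stepped up from \<open>{..<N}\<close> to \<open>{..<2 ^ N}\<close>. The shape of a set is
  recorded by the word of ascents and descents of the levels at which consecutive elements first differ;
  omitting an element deletes an end letter, merges two equal letters, or replaces a descent followed by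
  an ascent by a single letter that cannot be controlled. Sets with a constant word inherit their colour
  from the smaller colouring, and among the others a set of words is declared red such that every
  nonconstant word with one letter too many can be shortened to a nonconstant word that is not red, so the
  red clique number grows by exactly one. A simple choice of red words lets the blue clique number grow
  by a constant factor, which is affordable a bounded number of times. From uniformity \<open>7\<close> on, a finer
  choice, \<open>red_word\<close>, lets it grow only by \<open>2\<close> per step; the hypothesis \<open>n > 3 k\<close> then leaves at least
  \<open>n / 3\<close> for the uniformity \<open>7\<close> one starts with, so the constant does not depend on \<open>k\<close>.
\<close>

section \<open>Words closed under shortening\<close>

text \<open>Omitting an inner vertex replaces two adjacent levels by the larger one, so a level
  above both its neighbours is never the one that disappears. This is why \<open>word_closed\<close>
  has a rule for equal letters and for \<open>[False, True]\<close> but none for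
  \<open>[True, False]\<close>, and why redness is phrased through the positions of peaks. Two
  demands pull against each other: red words must be rare enough that every nonconstant word one
  letter longer escapes them, and frequent enough that a long word which stays nonconstant without
  either end letter reaches one. Uniformity \<open>7\<close> means words of \<open>6\<close>
  letters, enough to treat the two ends separately. The squared logarithm comes from graphs. With
  three colours on the triples one graph colour is stepped up without recording a direction, and
  then more than \<open>2 ^ r\<close> points yield a clique on only \<open>r + 1\<close> levels. So
  one clique number of the graph may be logarithmic in the other, and a random graph of density
  \<open>2 ^ -t\<close> achieves this on \<open>2 ^ (t * (t - 1))\<close> vertices.\<close>

text \<open>In words, \<^const>\<open>True\<close> is an ascent and \<^const>\<open>False\<close> a descent. The letter \<open>z\<close> that replaces a valley
  compares its two neighbours and is chosen by an adversary.\<close>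

definition word_closed :: "bool list set \<Rightarrow> bool" where
  "word_closed W \<longleftrightarrow>
     (\<forall>c\<in>W. tl c \<in> W \<and> butlast c \<in> W) \<and>
     (\<forall>ps x qs. ps @ [x, x] @ qs \<in> W \<longrightarrow> ps @ [x] @ qs \<in> W) \<and>
     (\<forall>ps qs. ps @ [False, True] @ qs \<in> W \<longrightarrow> (\<exists>z. ps @ [z] @ qs \<in> W))"

definition const_word :: "bool list \<Rightarrow> bool" where
  "const_word c \<longleftrightarrow> (\<exists>x. set c \<subseteq> {x})"

text \<open>Reading the levels from right to left reverses the word and exchanges ascents and
  descents. Arguments about one end thus carry over to the other.\<close>

definition mirror :: "bool list \<Rightarrow> bool list" where
  "mirror c = map Not (rev c)"

lemma word_closed_tl: "word_closed W \<Longrightarrow> c \<in> W \<Longrightarrow> tl c \<in> W"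
  and word_closed_butlast: "word_closed W \<Longrightarrow> c \<in> W \<Longrightarrow> butlast c \<in> W"
  and word_closed_merge: "word_closed W \<Longrightarrow> ps @ [x, x] @ qs \<in> W \<Longrightarrow> ps @ [x] @ qs \<in> W"
  and word_closed_valley: "word_closed W \<Longrightarrow> ps @ [False, True] @ qs \<in> W \<Longrightarrow> \<exists>z. ps @ [z] @ qs \<in> W"
  unfolding word_closed_def by blast+

lemma word_closed_suffix:
  assumes "word_closed W" shows "ps @ c \<in> W \<Longrightarrow> c \<in> W"
proof (induction ps)
  case (Cons a ps)
  then show ?case using word_closed_tl[OF assms, of "(a # ps) @ c"] by simp
qed simp

lemma word_closed_prefix:
  assumes "word_closed W" shows "c @ qs \<in> W \<Longrightarrow> c \<in> W"
proof (induction qs rule: rev_induct)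
  case (snoc a qs)
  then show ?case using word_closed_butlast[OF assms, of "c @ qs @ [a]"] by (simp add: butlast_append)
qed simp

lemma word_closed_factor: "word_closed W \<Longrightarrow> ps @ c @ qs \<in> W \<Longrightarrow> c \<in> W"
  using word_closed_suffix word_closed_prefix by blast

lemma word_closed_run:
  assumes "word_closed W" "1 \<le> i" "i \<le> j" "ps @ replicate j x @ qs \<in> W"
  shows "ps @ replicate i x @ qs \<in> W"
  using assms(3,4)
proof (induction j rule: dec_induct)
  case (step m)
  obtain m' where m': "m = Suc m'" using assms(2) step by (cases m) auto
  have "ps @ replicate (Suc m) x @ qs = ps @ [x, x] @ (replicate m' x @ qs)"
    by (simp add: m')
  then have "ps @ [x] @ (replicate m' x @ qs) \<in> W"
    using word_closed_merge[OF assms(1)] step.prems by metis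
  then show ?case using step.IH by (simp add: m')
qed

lemma length_2_obtain:
  assumes "length xs = 2" obtains a b where "xs = [a, b]"
  using assms by (cases xs; cases "tl xs") auto

lemma mirror_mirror [simp]: "mirror (mirror c) = c"
  by (simp add: mirror_def rev_map comp_def)

lemma length_mirror [simp]: "length (mirror c) = length c"
  by (simp add: mirror_def)

lemma const_word_mirror [simp]: "const_word (mirror c) = const_word c"
proof -
  have "const_word c \<Longrightarrow> const_word (mirror c)" for c
  proof -
    assume "const_word c"
    then obtain x where "set c \<subseteq> {x}" unfolding const_word_def by blast
    then have "set (mirror c) \<subseteq> {\<not> x}" unfolding mirror_def by auto
    then show ?thesis unfolding const_word_def by blast
  qed
  from this[of c] this[of "mirror c"] show ?thesis unfolding mirror_mirror by blast
qed

lemma mirror_append: "mirror (a @ b) = mirror b @ mirror a"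
  by (simp add: mirror_def)

lemma mirror_Nil [simp]: "mirror [] = []"
  and mirror_Cons: "mirror (x # a) = mirror a @ [\<not> x]"
  and mirror_replicate [simp]: "mirror (replicate n x) = replicate n (\<not> x)"
  by (simp_all add: mirror_def rev_map[symmetric])

lemma mirror_tl: "mirror (tl c) = butlast (mirror c)"
  by (cases c) (auto simp: mirror_Cons)

lemma mirror_butlast: "mirror (butlast c) = tl (mirror c)"
  by (metis mirror_mirror mirror_tl)

lemma mem_mirror_image: "c \<in> mirror ` W \<longleftrightarrow> mirror c \<in> W"
  by (metis imageE imageI mirror_mirror)

lemma word_closed_mirror:
  assumes "word_closed W" shows "word_closed (mirror ` W)"
  unfolding word_closed_def mem_mirror_image
proof (intro conjI ballI allI impI)
  fix c assume "c \<in> mirror ` W"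
  then have "mirror c \<in> W" by (simp add: mem_mirror_image)
  then show "mirror (tl c) \<in> W" "mirror (butlast c) \<in> W"
    using word_closed_tl[OF assms] word_closed_butlast[OF assms]
    by (auto simp: mirror_tl mirror_butlast)
next
  fix ps x qs assume "mirror (ps @ [x, x] @ qs) \<in> W"
  then show "mirror (ps @ [x] @ qs) \<in> W"
    using word_closed_merge[OF assms, of "mirror qs" "\<not> x" "mirror ps"]
    by (simp add: mirror_append mirror_Cons)
next
  fix ps qs assume "mirror (ps @ [False, True] @ qs) \<in> W"
  then obtain z where "mirror qs @ [z] @ mirror ps \<in> W"
    using word_closed_valley[OF assms, of "mirror qs" "mirror ps"]
    by (auto simp: mirror_append mirror_Cons)
  then have "mirror (ps @ [\<not> z] @ qs) \<in> W" by (simp add: mirror_append mirror_Cons)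
  then show "\<exists>z. mirror (ps @ [z] @ qs) \<in> W" by blast
qed

text \<open>The segment starts with a descent: a second descent merges with it, an ascent forms a
  valley with it. The letters of \<open>v\<close> are not controlled, but \<open>ps\<close> and
  \<open>qs\<close> stay.\<close>

lemma word_closed_shorten_ascent:
  assumes "word_closed W"
  shows "ps @ (False # u @ [True]) @ qs \<in> W \<Longrightarrow> \<exists>v. length v = Suc (length u) \<and> ps @ v @ qs \<in> W"
proof (induction u arbitrary: ps)
  case Nil
  then obtain z where "ps @ [z] @ qs \<in> W"
    using word_closed_valley[OF assms, of ps qs] by auto
  then show ?case by (metis length_Cons list.size(3))
next
  case (Cons b u)
  show ?case
  proof (cases b)
    case True
    then obtain z where "ps @ [z] @ (u @ [True] @ qs) \<in> W"
      using Cons.prems word_closed_valley[OF assms, of ps "u @ [True] @ qs"] by auto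
    then have "ps @ (z # u @ [True]) @ qs \<in> W" by simp
    then show ?thesis by (metis length_Cons length_append_singleton)
  next
    case False
    then have "ps @ [False] @ (u @ [True] @ qs) \<in> W"
      using Cons.prems word_closed_merge[OF assms, of ps False "u @ [True] @ qs"] by auto
    then have "ps @ (False # u @ [True]) @ qs \<in> W" by simp
    then show ?thesis by (metis length_Cons length_append_singleton)
  qed
qed

text \<open>The leading ascent can be kept: it merges with an ascent next to it, and otherwise the
  stretch from the following descent to the last ascent is shortened.\<close>

lemma word_closed_shorten:
  assumes "word_closed W" "ps @ (True # u @ [True]) @ qs \<in> W"
  shows "\<exists>v. length v = length u \<and> ps @ (True # v) @ qs \<in> W"
proof (cases u)
  case Nil
  then show ?thesis using word_closed_merge[OF assms(1), of ps True qs] assms(2) by auto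
next
  case (Cons a u')
  show ?thesis
  proof (cases a)
    case True
    then have "ps @ [True, True] @ (u' @ [True] @ qs) \<in> W" using assms(2) Cons by simp
    from word_closed_merge[OF assms(1) this] have "ps @ (True # (u' @ [True])) @ qs \<in> W" by simp
    then show ?thesis using Cons by (metis length_Cons length_append_singleton)
  next
    case False
    then have "(ps @ [True]) @ (False # u' @ [True]) @ qs \<in> W" using assms(2) Cons by simp
    from word_closed_shorten_ascent[OF assms(1) this] show ?thesis using Cons by auto
  qed
qed

section \<open>Red words for the sharp stepping-up step\<close>

definition peak :: "bool list \<Rightarrow> nat \<Rightarrow> bool" where
  "peak c i \<longleftrightarrow> c ! i \<and> \<not> c ! Suc i"

text \<open>Dropping the first letter moves a peak one step to the left, so peaks next to an end position are red
  and peaks at an end position blue. This leaves long words without red subwords that are constant up to two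
  letters at the ends; the special words make these red. Each exceptional word, preceded by any letter, loses
  its red colour because otherwise it would reach only red words.\<close>

definition special_words :: "nat \<Rightarrow> bool list set" where
  "special_words l = {[False, False] @ replicate (l - 2) True,
     [True, False] @ replicate (l - 2) True,
     [True] @ replicate (l - 2) False @ [True]}"

definition exceptional_words :: "nat \<Rightarrow> bool list set" where
  "exceptional_words l = {[True, False] @ replicate (l - 2) True, [True] @ replicate (l - 2) False @ [True]}"

definition red_word :: "bool list \<Rightarrow> bool" where
  "red_word c \<longleftrightarrow> (let l = length c in
     (peak c 1 \<or> peak c (l - 3)) \<and> \<not> (peak c 0 \<or> peak c (l - 2)) \<and>
     tl c \<notin> exceptional_words (l - 1) \<and> mirror (butlast c) \<notin> exceptional_words (l - 1) \<or>
     c \<in> special_words l \<or> mirror c \<in> special_words l)"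

lemma peak_mirror:
  assumes "Suc i < length c"
  shows "peak (mirror c) i = peak c (length c - 2 - i)"
proof -
  obtain n where n: "length c = i + 2 + n" using assms by (metis Suc_leI add_2_eq_Suc' le_Suc_ex)
  have "mirror c ! i \<longleftrightarrow> \<not> c ! Suc n" "mirror c ! Suc i \<longleftrightarrow> \<not> c ! n"
    by (simp_all add: mirror_def rev_nth n)
  moreover have "length c - 2 - i = n" using n by simp
  ultimately show ?thesis unfolding peak_def by blast
qed

lemma red_word_mirror:
  assumes "length c \<ge> 6"
  shows "red_word (mirror c) = red_word c"
proof -
  obtain k where k: "length c = k + 6" using assms by (metis add.commute le_Suc_ex)
  have p: "peak (mirror c) 1 = peak c (length c - 3)" "peak (mirror c) 0 = peak c (length c - 2)"
    "peak (mirror c) (length c - 3) = peak c 1" "peak (mirror c) (length c - 2) = peak c 0"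
    using peak_mirror[of 1 c] peak_mirror[of 0 c] peak_mirror[of "k + 3" c] peak_mirror[of "k + 4" c]
    by (simp_all add: k add.commute)
  show ?thesis
    unfolding red_word_def Let_def length_mirror p mirror_butlast mirror_mirror mirror_tl[symmetric]
    by (simp only: conj_ac disj_ac)
qed

text \<open>The descent at \<open>i\<close> keeps \<open>tl c\<close> from being the exceptional
  word that ascends after its first peak, and the last hypothesis keeps it from being the other one.
  The mirrored exceptional words disagree with \<open>c\<close> in position \<open>1\<close> or
  \<open>2\<close>.\<close>

lemma red_word_peakI:
  assumes "length c \<ge> 6" "c ! 1" "\<not> c ! 2" "\<not> peak c (length c - 2)"
    and "i < length c" "i \<ge> 3" "\<not> c ! i"
    and "(\<exists>j \<ge> 2. Suc j < length c \<and> c ! j) \<or> \<not> c ! (length c - 1)"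
  shows "red_word c"
proof -
  obtain k where k: "length c = k + 6" using assms(1) by (metis add.commute le_Suc_ex)
  have 1: "peak c 1" "\<not> peak c 0" using assms(2,3) by (auto simp: peak_def numeral_2_eq_2)
  have tl: "tl c ! n = c ! Suc n" if "n < k + 5" for n using that k by (simp add: nth_tl)
  have bl: "butlast c ! n = c ! n" if "n < k + 5" for n using that k by (simp add: nth_butlast)
  have 2: "tl c \<noteq> [True, False] @ replicate (k + 3) True"
  proof
    assume *: "tl c = [True, False] @ replicate (k + 3) True"
    have "tl c ! (i - 1)" unfolding * using assms(5,6) k
      by (simp add: nth_append nth_Cons')
    moreover have "i - 1 < k + 5" using assms(5,6) k by linarith
    ultimately show False using tl[of "i - 1"] assms(5-7) by simp
  qed
  have 3: "tl c \<noteq> [True] @ replicate (k + 3) False @ [True]"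
  proof
    assume *: "tl c = [True] @ replicate (k + 3) False @ [True]"
    have "tl c ! (k + 4)" by (simp add: * nth_append nth_Cons')
    then have "c ! (length c - 1)" using tl[of "k + 4"] k by (simp add: eval_nat_numeral)
    then obtain j where j: "j \<ge> 2" "Suc j < length c" "c ! j" using assms(8) by blast
    then have "j - 1 < k + 5" using k by linarith
    moreover have "\<not> tl c ! (j - 1)" unfolding * using j k by (simp add: nth_append nth_Cons')
    ultimately show False using tl[of "j - 1"] j by simp
  qed
  have 4: "butlast c \<noteq> replicate (k + 3) False @ [True, False]"
    using bl[of 1] assms(2) by (auto simp: nth_append)
  have 5: "butlast c \<noteq> [False] @ replicate (k + 3) True @ [False]"
    using bl[of 2] assms(3) by (auto simp: nth_append)
  have m: "mirror d = e \<longleftrightarrow> d = mirror e" for d e by (metis mirror_mirror)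
  have "length c - 1 - 2 = k + 3" using k by simp
  then have "tl c \<notin> exceptional_words (length c - 1)" "mirror (butlast c) \<notin> exceptional_words (length c - 1)"
    using 2 3 4 5 unfolding exceptional_words_def m by (simp_all add: m mirror_append mirror_Cons)
  then show ?thesis unfolding red_word_def Let_def using 1 assms(4) by blast
qed

text \<open>The first \<open>l\<close> letters have a peak in position \<open>1\<close> and fail to
  be red in only three ways: only ascents after the peak, only descents up to a final ascent, or a
  peak at the end. The two remaining letters give room for a different shortening in each
  case.\<close>

lemma red_word_interior_peak:
  assumes W: "word_closed W" and c: "[x, True, False] @ qs \<in> W" "length qs = l - 1" and l: "l \<ge> 6"
  shows "\<exists>r\<in>W. length r = l \<and> red_word r"
proof -
  obtain k where k: "l = k + 6" using l by (metis add.commute le_Suc_ex)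
  have lq: "length qs = k + 5" using c k by simp
  obtain q1 q2 ts where ts: "qs = ts @ [q1, q2]" "length ts = k + 3"
  proof -
    have "length (drop (k+3) qs) = 2" using lq by simp
    then obtain a b where "drop (k+3) qs = [a, b]" by (rule length_2_obtain)
    then have "qs = take (k+3) qs @ [a, b]" by (metis append_take_drop_id)
    moreover have "length (take (k+3) qs) = k + 3" using lq by simp
    ultimately show ?thesis using that by blast
  qed
  let ?r = "[x, True, False] @ ts"
  have rW: "?r \<in> W" using word_closed_prefix[OF W, of ?r "[q1, q2]"] c ts by simp
  show ?thesis
  proof (cases "red_word ?r")
    case True
    then show ?thesis using rW ts k by (intro bexI[of _ ?r]) auto
  next
    case False
    have nr: "length ?r = k + 6" using ts by simp
    consider (up) "ts = replicate (k+3) True"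
      | (valley) "ts = replicate (k+2) False @ [True]"
      | (peak) "peak ?r (k + 4)"
    proof -
      have "ts = replicate (k+3) True" if "\<forall>i<k+6. i \<ge> 3 \<longrightarrow> ?r ! i"
      proof (rule nth_equalityI)
        fix i assume "i < length ts"
        then show "ts ! i = replicate (k+3) True ! i" using ts that[rule_format, of "i+3"] by simp
      qed (simp add: ts)
      moreover have "ts = replicate (k+2) False @ [True]"
        if "\<forall>j\<ge>2. Suc j < k + 6 \<longrightarrow> \<not> ?r ! j" "?r ! (k + 5)"
      proof (rule nth_equalityI)
        fix i assume "i < length ts"
        then show "ts ! i = (replicate (k+2) False @ [True]) ! i"
          using ts that(1)[rule_format, of "i+3"] that(2)
          by (cases "i = k + 2") (auto simp: nth_append nth_Cons')
      qed (simp add: ts)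
      moreover have "peak ?r (k + 4) \<or> (\<forall>i<k+6. i \<ge> 3 \<longrightarrow> ?r ! i) \<or> (\<forall>j\<ge>2. Suc j < k + 6 \<longrightarrow> \<not> ?r ! j) \<and> ?r ! (k + 5)"
      proof (rule ccontr)
        assume *: "\<not> ?thesis"
        then obtain i where i: "i < k + 6" "i \<ge> 3" "\<not> ?r ! i" by blast
        have "red_word ?r"
          proof (rule red_word_peakI[of _ i])
            have "length ?r - 2 = k + 4" "length ?r - 1 = k + 5" "\<And>j. Suc j < length ?r \<longleftrightarrow> Suc j < k + 6"
              using nr by simp_all
            then show "\<not> peak ?r (length ?r - 2)"
              "(\<exists>j\<ge>2. Suc j < length ?r \<and> ?r ! j) \<or> \<not> ?r ! (length ?r - 1)" using * by metis+
          qed (use i nr in simp_all)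
        then show False using False by simp
      qed
      ultimately show ?thesis using that by blast
    qed
    then show ?thesis
    proof cases
      case up
      show ?thesis
      proof (cases q1)
        case True
        \<comment> \<open>Dropping \<open>x\<close> and the last letter leaves a special
          word.\<close>
        let ?s = "[True, False] @ replicate (k+4) True"
        have "[x] @ ?s @ [q2] \<in> W" using c ts up True
          by (simp add: replicate_app_Cons_same eval_nat_numeral)
        then have "?s \<in> W" using word_closed_factor[OF W] by blast
        moreover have "red_word ?s" by (simp add: red_word_def Let_def special_words_def)
        ultimately show ?thesis using k by (intro bexI[of _ ?s]) auto
      next
        case F: False
        let ?s = "[x, True, False] @ replicate (k+1) True @ [False, q2]"
        have "[x, True, False] @ replicate (k+3) True @ [False, q2] \<in> W" using c ts up F by simp
        then have "?s \<in> W" using word_closed_run[OF W, of "k+1" "k+3" "[x, True, False]"] by simp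
        moreover have "red_word ?s"
          by (rule red_word_peakI[of _ "k+4"]) (auto simp: peak_def nth_append nth_Cons' intro!: exI[of _ 3])
        ultimately show ?thesis using k by (intro bexI[of _ ?s]) auto
      qed
    next
      case valley
      have cc: "[x, True] @ replicate (k+3) False @ [True, q1, q2] \<in> W"
        using c ts valley by (simp add: eval_nat_numeral)
      show ?thesis
      proof (cases q1)
        case True
        let ?s = "[x, True] @ replicate (k+2) False @ [True, True]"
        have "([x, True] @ replicate (k+3) False @ [True, True]) @ [q2] \<in> W"
          using cc True by simp
        then have "[x, True] @ replicate (k+3) False @ [True, True] \<in> W"
          by (rule word_closed_prefix[OF W])
        then have "?s \<in> W" using word_closed_run[OF W, of "k+2" "k+3" "[x, True]"] by simp
        moreover have "red_word ?s"
          by (rule red_word_peakI[of _ "3"]) (auto simp: peak_def nth_append nth_Cons' intro!: exI[of _ "k+4"])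
        ultimately show ?thesis using k by (intro bexI[of _ ?s]) auto
      next
        case F: False
        let ?s = "[x, True] @ replicate (k+1) False @ [True, False, q2]"
        have "?s \<in> W" using word_closed_run[OF W, of "k+1" "k+3" "[x, True]"] cc F by simp
        moreover have "red_word ?s"
          by (rule red_word_peakI[of _ "k+4"]) (auto simp: peak_def nth_append nth_Cons' intro!: exI[of _ "k+3"])
        ultimately show ?thesis using k by (intro bexI[of _ ?s]) auto
      qed
    next
      case peak
      obtain us where us: "ts = us @ [True, False]" "length us = k + 1"
      proof -
        have "length (drop (k+1) ts) = 2" using ts by simp
        then obtain a b where ab: "drop (k+1) ts = [a, b]" by (rule length_2_obtain)
        then have t: "ts = take (k+1) ts @ [a, b]" by (metis append_take_drop_id)
        have "ts ! (k+1)" "\<not> ts ! (k+2)" using peak by (auto simp: peak_def)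
        then have "a" "\<not> b" using ts(2) by (subst (asm) t, simp add: nth_append)+
        then have "ts = take (k+1) ts @ [True, False]" using t by simp
        moreover have "length (take (k+1) ts) = k + 1" using ts by simp
        ultimately show ?thesis using that by blast
      qed
      then obtain a vs where vs: "us = a # vs" "length vs = k" by (cases us) auto
      have cc: "[x, True, False, a] @ vs @ [True, False, q1, q2] \<in> W" using c ts us vs by simp
      \<comment> \<open>Shortening the interior by one moves the final descent one place inwards, so
        no peak remains at the end. An ascent is kept at one end of \<open>m\<close> to rule out the
        second exceptional word.\<close>
      have "\<exists>m. length m = k + 1 \<and> (m ! 0 \<or> m ! k) \<and> [x, True, False] @ m @ [False, q1] \<in> W"
      proof (cases a)
        case True
        have "[x, True, False] @ (True # vs @ [True]) @ [False, q1, q2] \<in> W" using cc True by simp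
        from word_closed_shorten[OF W this] obtain v where v: "length v = k"
          "[x, True, False] @ (True # v) @ [False, q1, q2] \<in> W" using vs by auto
        then have "([x, True, False] @ (True # v) @ [False, q1]) @ [q2] \<in> W" by simp
        then have "[x, True, False] @ (True # v) @ [False, q1] \<in> W" by (rule word_closed_prefix[OF W])
        then show ?thesis using v by (intro exI[of _ "True # v"]) auto
      next
        case F: False
        have "[x, True] @ [False, False] @ (vs @ [True, False, q1, q2]) \<in> W" using cc F by simp
        from word_closed_merge[OF W this]
        have "([x, True, False] @ (vs @ [True]) @ [False, q1]) @ [q2] \<in> W" by simp
        then have "[x, True, False] @ (vs @ [True]) @ [False, q1] \<in> W" by (rule word_closed_prefix[OF W])
        then show ?thesis using vs by (intro exI[of _ "vs @ [True]"]) auto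
      qed
      then obtain m where m: "length m = k + 1" "m ! 0 \<or> m ! k" "[x, True, False] @ m @ [False, q1] \<in> W"
        by blast
      have "red_word ([x, True, False] @ m @ [False, q1])"
      proof (rule red_word_peakI[of _ "k+4"])
        show "(\<exists>j\<ge>2. Suc j < length ([x, True, False] @ m @ [False, q1]) \<and> ([x, True, False] @ m @ [False, q1]) ! j) \<or>
          \<not> ([x, True, False] @ m @ [False, q1]) ! (length ([x, True, False] @ m @ [False, q1]) - 1)"
          using m(1,2) by (auto simp: nth_append intro: exI[of _ 3] exI[of _ "k+3"])
      qed (use m(1) in \<open>auto simp: peak_def nth_append nth_Cons'\<close>)
      then show ?thesis using m k by (intro bexI[OF _ m(3)]) auto
    qed
  qed
qed

lemma special_words_iff:
  "mirror c \<in> special_words l \<or> c \<in> special_words l \<longleftrightarrow>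
     c = [False, False] @ replicate (l - 2) True \<or>
     c = replicate (l - 2) False @ [True, True] \<or>
     c = [True, False] @ replicate (l - 2) True \<or>
     c = [True] @ replicate (l - 2) False @ [True] \<or>
     c = replicate (l - 2) False @ [True, False] \<or>
     c = [False] @ replicate (l - 2) True @ [False]"
proof -
  have "mirror c = w \<longleftrightarrow> c = mirror w" for w by (metis mirror_mirror)
  then have "mirror c \<in> special_words l \<longleftrightarrow> c \<in> mirror ` special_words l" by (metis mem_mirror_image)
  also have "mirror ` special_words l = {replicate (l - 2) False @ [True, True],
      replicate (l - 2) False @ [True, False], [False] @ replicate (l - 2) True @ [False]}"
    by (simp add: special_words_def mirror_append mirror_Cons)
  finally show ?thesis unfolding special_words_def by (simp only: insert_iff empty_iff) argo
qed

text \<open>Six letters near the ends suffice to tell the special words from the candidates that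
  arise later, whatever the length of the runs in between.\<close>

lemma special_words_ends:
  assumes "mirror c \<in> special_words (k + 6) \<or> c \<in> special_words (k + 6)"
  shows "(c ! 0, c ! 1, c ! 2, c ! (k + 3), c ! (k + 4), c ! (k + 5)) \<in>
    {(False, False, True, True, True, True), (False, False, False, False, True, True),
     (True, False, True, True, True, True), (True, False, False, False, False, True),
     (False, False, False, False, True, False), (False, True, True, True, True, False)}"
  using assms unfolding special_words_iff
  by (elim disjE) (simp_all add: nth_append nth_Cons')

lemma const_word_nth: "const_word c \<longleftrightarrow> (\<forall>i<length c. \<forall>j<length c. c ! i = c ! j)"
proof
  assume "\<forall>i<length c. \<forall>j<length c. c ! i = c ! j"
  then have "x = c ! 0" if "x \<in> set c" for x
    using that by (metis in_set_conv_nth length_pos_if_in_set)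
  then show "const_word c" unfolding const_word_def by blast
next
  assume "const_word c"
  then obtain x where "set c \<subseteq> {x}" unfolding const_word_def by blast
  then have "c ! i = x" if "i < length c" for i using nth_mem[OF that] by blast
  then show "\<forall>i<length c. \<forall>j<length c. c ! i = c ! j" by simp
qed

lemma red_word_not_const:
  assumes "red_word c" "length c \<ge> 6" shows "\<not> const_word c"
proof
  assume "const_word c"
  then have c: "c ! i = c ! j" if "i < length c" "j < length c" for i j
    using that unfolding const_word_nth by blast
  obtain k where k: "length c = k + 6" using assms(2) by (metis add.commute le_Suc_ex)
  have "\<not> peak c i" if "i < k + 5" for i
    using that c[of i "Suc i"] k by (auto simp: peak_def)
  then have "\<not> peak c 1" "\<not> peak c (k + 3)" by simp_all
  then have "mirror c \<in> special_words (k + 6) \<or> c \<in> special_words (k + 6)"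
    using assms(1) k unfolding red_word_def Let_def by (auto simp: add.commute)
  from special_words_ends[OF this] show False
    using c[of 0 1] c[of 1 2] c[of 2 "k+3"] c[of "k+3" "k+4"] c[of "k+4" "k+5"] k by auto
qed

text \<open>One side of the peak has at least \<open>l - 1\<close> letters; of the other side only
  the letter next to the peak is kept. If the long side is the left one, reflect.\<close>

lemma red_word_of_interior_peak:
  assumes W: "word_closed W" and c: "ps @ [True, False] @ qs \<in> W" "ps \<noteq> []" "qs \<noteq> []"
    and l: "l \<ge> 6" "length ps + length qs \<ge> 2 * l - 2"
  shows "\<exists>r\<in>W. length r = l \<and> red_word r"
proof (cases "length qs \<ge> l - 1")
  case True
  obtain ps' x where "ps = ps' @ [x]" using c(2) by (metis append_butlast_last_id)
  then have "ps' @ ([x, True, False] @ take (l - 1) qs) @ drop (l - 1) qs \<in> W" using c(1) by simp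
  then have "[x, True, False] @ take (l - 1) qs \<in> W" by (rule word_closed_factor[OF W])
  then show ?thesis using True l by (intro red_word_interior_peak[OF W]) auto
next
  case False
  then have len: "length ps \<ge> l - 1" using l by linarith
  obtain x qs' where q: "qs = x # qs'" using c(3) by (cases qs) auto
  have "mirror (ps @ [True, False] @ qs) \<in> mirror ` W" using c(1) by blast
  then have "mirror qs' @ ([\<not> x, True, False] @ take (l - 1) (mirror ps)) @ drop (l - 1) (mirror ps) \<in> mirror ` W"
    by (simp add: q mirror_append mirror_Cons)
  then have "[\<not> x, True, False] @ take (l - 1) (mirror ps) \<in> mirror ` W"
    by (rule word_closed_factor[OF word_closed_mirror[OF W]])
  then have "\<exists>r\<in>mirror ` W. length r = l \<and> red_word r"
    using len l by (intro red_word_interior_peak[OF word_closed_mirror[OF W]]) auto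
  then show ?thesis using l by (auto simp: red_word_mirror)
qed

lemma peak_free_word:
  "(\<And>ps qs. c \<noteq> ps @ [True, False] @ qs) \<Longrightarrow> \<exists>a b. c = replicate a False @ replicate b True"
proof (induction c)
  case Nil
  show ?case by (intro exI[of _ 0]) simp
next
  case (Cons x c)
  have "c \<noteq> ps @ [True, False] @ qs" for ps qs using Cons.prems[of "x # ps" qs] by simp
  then obtain a b where ab: "c = replicate a False @ replicate b True" using Cons.IH by blast
  show ?case
  proof (cases x)
    case False
    then show ?thesis by (intro exI[of _ "Suc a"] exI[of _ b]) (simp add: ab)
  next
    case True
    have "a = 0" using Cons.prems[of "[]" "tl c"] ab True by (cases a) auto
    then show ?thesis by (intro exI[of _ 0] exI[of _ "Suc b"]) (simp add: ab True)
  qed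
qed

text \<open>Without its end letters \<open>c\<close> has a peak, or consists of descents followed by
  ascents and its runs shorten to a special word. The two nonconstancy hypotheses matter when this
  middle part is constant: they force both end letters to differ from it.\<close>

lemma red_word_unavoidable:
  assumes W: "word_closed W" and c: "c \<in> W" "length c \<ge> 2 * l" and l: "l \<ge> 6"
    and nc: "\<not> const_word (tl c)" "\<not> const_word (butlast c)"
  shows "\<exists>r\<in>W. length r = l \<and> red_word r"
proof (rule ccontr)
  assume neg: "\<not> ?thesis"
  have special: False if "r \<in> W" "mirror r \<in> special_words l \<or> r \<in> special_words l" for r
  proof -
    have "length r = l" using that(2) l unfolding special_words_iff by auto
    moreover from this have "red_word r" using that(2) unfolding red_word_def Let_def by auto
    ultimately show False using neg that(1) by blast
  qed
  define e where "e = last c"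
  define mid where "mid = tl (butlast c)"
  obtain f where ce: "c = f # mid @ [e]"
    using c(2) l unfolding mid_def e_def
    by (cases c; cases "tl c") auto
  have run: "ps @ replicate i x @ qs \<in> W" if "ps @ replicate j x @ qs \<in> W" "1 \<le> i" "i \<le> j" for ps qs i j x
    using word_closed_run[OF W that(2,3,1)] .
  have factor: "r \<in> W" if "ps @ r @ qs \<in> W" for ps r qs using word_closed_factor[OF W that] .
  have "mid \<noteq> ps @ [True, False] @ qs" for ps qs
  proof
    assume m: "mid = ps @ [True, False] @ qs"
    have "(f # ps) @ [True, False] @ (qs @ [e]) \<in> W" using c(1) ce m by simp
    then have "\<exists>r\<in>W. length r = l \<and> red_word r"
      by (rule red_word_of_interior_peak[OF W]) (use c(2) l ce m in auto)
    then show False using neg by blast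
  qed
  then obtain a b where ab: "mid = replicate a False @ replicate b True" using peak_free_word by blast
  have len: "a + b \<ge> 2 * l - 2" using c(2) ce ab by simp
  have cW: "[f] @ replicate a False @ replicate b True @ [e] \<in> W" using c(1) ce ab by simp
  have valley3: False if "replicate i False @ replicate j True \<in> W" "i \<ge> 2" "j \<ge> l - 2" for i j
  proof -
    have "[] @ replicate 2 False @ replicate j True \<in> W"
      by (rule run[of _ i]) (use that in auto)
    then have "replicate 2 False @ replicate j True @ [] \<in> W" by simp
    then have "replicate 2 False @ replicate (l - 2) True @ [] \<in> W"
      by (rule run[of _ j]) (use that l in auto)
    then show False by (rule special) (simp add: special_words_iff eval_nat_numeral)
  qed
  have valley4: False if "replicate i False @ replicate j True \<in> W" "j \<ge> 2" "i \<ge> l - 2" for i j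
  proof -
    have "replicate i False @ replicate j True @ [] \<in> W" using that by simp
    then have "replicate i False @ replicate 2 True @ [] \<in> W"
      by (rule run[of _ j]) (use that in auto)
    then have "[] @ replicate i False @ replicate 2 True \<in> W" by simp
    then have "[] @ replicate (l - 2) False @ replicate 2 True \<in> W"
      by (rule run[of _ i]) (use that l in auto)
    then show False by (rule special) (simp add: special_words_iff eval_nat_numeral)
  qed
  consider "a \<ge> 2" "b \<ge> 2" | "a = 0" | "b = 0" | "a = 1" "b \<ge> 2" | "b = 1" "a \<ge> 2"
    using len l by linarith
  then show False
  proof cases
    case 1
    have "replicate a False @ replicate b True \<in> W"
      using factor[of "[f]" "replicate a False @ replicate b True" "[e]"] cW by simp
    moreover have "a \<ge> l - 2 \<or> b \<ge> l - 2" using len by linarith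
    ultimately show False using valley3 valley4 1 by blast
  next
    case 2
    have f: "\<not> f"
    proof
      assume f
      then have "set (butlast c) \<subseteq> {True}" using ce ab 2 by auto
      then show False using nc unfolding const_word_def by blast
    qed
    have e: "\<not> e"
    proof
      assume e
      then have "set (tl c) \<subseteq> {True}" using ce ab 2 by auto
      then show False using nc unfolding const_word_def by blast
    qed
    have "[False] @ replicate b True @ [False] \<in> W" using cW f e 2 by simp
    then have "[False] @ replicate (l - 2) True @ [False] \<in> W"
      by (rule run) (use len l 2 in auto)
    then show False by (rule special) (simp add: special_words_iff)
  next
    case 3
    have f: "f"
    proof (rule ccontr)
      assume "\<not> f"
      then have "set (butlast c) \<subseteq> {False}" using ce ab 3 by auto
      then show False using nc unfolding const_word_def by blast
    qed
    have e: "e"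
    proof (rule ccontr)
      assume "\<not> e"
      then have "set (tl c) \<subseteq> {False}" using ce ab 3 by auto
      then show False using nc unfolding const_word_def by blast
    qed
    have "[True] @ replicate a False @ [True] \<in> W" using cW f e 3 by simp
    then have "[True] @ replicate (l - 2) False @ [True] \<in> W"
      by (rule run) (use len l 3 in auto)
    then show False by (rule special) (simp add: special_words_iff)
  next
    case 4
    have W': "[f, False] @ replicate b True \<in> W"
      using factor[of "[]" "[f, False] @ replicate b True" "[e]"] cW 4 by simp
    show False
    proof (cases f)
      case True
      have "[True, False] @ replicate b True @ [] \<in> W" using W' True by simp
      then have "[True, False] @ replicate (l - 2) True @ [] \<in> W"
        by (rule run) (use len l 4 in auto)
      then show False by (rule special) (simp add: special_words_iff)
    next
      case False
      have "b \<ge> l - 2" using len l 4 by linarith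
      then show False using W' valley3[of 2 b] False by (simp add: numeral_2_eq_2)
    qed
  next
    case 5
    have W': "replicate a False @ [True, e] \<in> W"
      using factor[of "[f]" "replicate a False @ [True, e]" "[]"] cW 5 by simp
    show False
    proof (cases e)
      case False
      have "[] @ replicate a False @ [True, False] \<in> W" using W' False by simp
      then have "[] @ replicate (l - 2) False @ [True, False] \<in> W"
        by (rule run) (use len l 5 in auto)
      then show False by (rule special) (simp add: special_words_iff)
    next
      case True
      have "a \<ge> l - 2" using len l 5 by linarith
      then show False using W' valley4[of a 2] True by (simp add: numeral_2_eq_2)
    qed
  qed
qed

section \<open>Nonconstant words with one letter more escape the red words\<close>

lemma special_words_peak:
  assumes "mirror r \<in> special_words (k + 6) \<or> r \<in> special_words (k + 6)" "peak r i" "i < k + 5"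
  shows "i = 0 \<or> i = k + 4"
  using assms unfolding special_words_iff peak_def
  by (elim disjE) (auto simp: nth_append nth_Cons' split: if_splits)

lemma not_red_wordI:
  assumes "length r = k + 6"
    and "\<not> peak r 1 \<and> \<not> peak r (k + 3) \<or> peak r 0 \<or> peak r (k + 4) \<or>
      tl r \<in> exceptional_words (k + 5)"
    and "(r ! 0, r ! 1, r ! 2, r ! (k + 3), r ! (k + 4), r ! (k + 5)) \<notin>
    {(False, False, True, True, True, True), (False, False, False, False, True, True),
     (True, False, True, True, True, True), (True, False, False, False, False, True),
     (False, False, False, False, True, False), (False, True, True, True, True, False)}"
  shows "\<not> red_word r"
proof -
  have "k + 6 - 3 = k + 3" "k + 6 - 2 = k + 4" "k + 6 - 1 = k + 5" by simp_all
  then show ?thesis using special_words_ends[of r k] assms unfolding red_word_def Let_def by metis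
qed

text \<open>The peak survives in \<open>butlast c\<close>, and the only red words with a peak in
  position \<open>0\<close> are two special ones. For both of them another shortening of
  \<open>c\<close> is neither constant nor red.\<close>

lemma no_escape_peak_0:
  assumes W: "word_closed W" and bad: "\<And>r. r \<in> W \<Longrightarrow> length r = k + 6 \<Longrightarrow> const_word r \<or> red_word r"
    and c: "c \<in> W" "length c = k + 7"
  shows "\<not> peak c 0"
proof
  assume p: "peak c 0"
  define w x where "w = butlast c" and "x = last c"
  have cw: "c = w @ [x]" using c by (cases c) (auto simp: w_def x_def)
  then have lw: "length w = k + 6" using c by simp
  then have pw: "peak w 0" using p cw by (auto simp: peak_def nth_append)
  then have "\<not> const_word w" using lw unfolding const_word_nth peak_def by force
  moreover have "w \<in> W" using word_closed_prefix[OF W, of w "[x]"] c cw by simp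
  ultimately have "red_word w" using bad lw by blast
  then have "mirror w \<in> special_words (k + 6) \<or> w \<in> special_words (k + 6)"
    using pw lw unfolding red_word_def Let_def by auto
  moreover have "w ! 0" "\<not> w ! 1" using pw by (auto simp: peak_def)
  ultimately consider (1) "w = [True, False] @ replicate (k + 4) True"
    | (2) "w = [True] @ replicate (k + 4) False @ [True]"
    unfolding special_words_iff by (elim disjE) (auto simp: nth_append)
  then show False
  proof cases
    case 1
    show False
    proof (cases x)
      case True
      let ?r = "[False] @ replicate (k + 5) True"
      have "[True] @ ?r \<in> W" using c cw 1 True by (simp add: replicate_append_same eval_nat_numeral)
      then have "?r \<in> W" by (rule word_closed_suffix[OF W])
      moreover have "\<not> red_word ?r" by (rule not_red_wordI[where k=k]) (auto simp: peak_def nth_append nth_Cons')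
      moreover have "\<not> const_word ?r" unfolding const_word_def by auto
      ultimately show False using bad[of ?r] by simp
    next
      case False
      let ?r = "[True, False] @ replicate (k + 3) True @ [False]"
      have "[True, False] @ replicate (k + 4) True @ [False] \<in> W" using c cw 1 False by simp
      then have "?r \<in> W" by (rule word_closed_run[OF W, rotated 2]) auto
      moreover have "\<not> red_word ?r" by (rule not_red_wordI[where k=k]) (auto simp: peak_def nth_append nth_Cons')
      moreover have "\<not> const_word ?r" unfolding const_word_def by auto
      ultimately show False using bad[of ?r] by simp
    qed
  next
    case 2
    let ?r = "[True] @ replicate (k + 3) False @ [True, x]"
    have "[True] @ replicate (k + 4) False @ [True, x] \<in> W" using c cw 2 by simp
    then have "?r \<in> W" by (rule word_closed_run[OF W, rotated 2]) auto
    moreover have "\<not> red_word ?r" by (rule not_red_wordI[where k=k]) (auto simp: peak_def nth_append nth_Cons')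
    moreover have "\<not> const_word ?r" unfolding const_word_def by auto
    ultimately show False using bad[of ?r] by simp
  qed
qed

text \<open>Here \<open>tl c\<close> begins with a peak and is one of two special words. Shortening
  its run by one and keeping \<open>f\<close> leaves a word with exceptional tail, which is not
  red.\<close>

lemma no_escape_peak_1:
  assumes W: "word_closed W" and bad: "\<And>r. r \<in> W \<Longrightarrow> length r = k + 6 \<Longrightarrow> const_word r \<or> red_word r"
    and c: "c \<in> W" "length c = k + 7"
  shows "\<not> peak c 1"
proof
  assume p: "peak c 1"
  obtain f w where cw: "c = f # w" using c by (cases c) auto
  then have lw: "length w = k + 6" using c by simp
  then have pw: "peak w 0" using p cw by (auto simp: peak_def)
  then have "\<not> const_word w" using lw unfolding const_word_nth peak_def by force
  moreover have "w \<in> W" using word_closed_suffix[OF W, of "[f]" w] c cw by simp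
  ultimately have "red_word w" using bad lw by blast
  then have "mirror w \<in> special_words (k + 6) \<or> w \<in> special_words (k + 6)"
    using pw lw unfolding red_word_def Let_def by auto
  moreover have "w ! 0" "\<not> w ! 1" using pw by (auto simp: peak_def)
  ultimately consider (1) "w = [True, False] @ replicate (k + 4) True"
    | (2) "w = [True] @ replicate (k + 4) False @ [True]"
    unfolding special_words_iff by (elim disjE) (auto simp: nth_append)
  then show False
  proof cases
    case 1
    let ?r = "[f, True, False] @ replicate (k + 3) True"
    have "[f, True, False] @ replicate (k + 4) True @ [] \<in> W" using c cw 1 by simp
    then have "[f, True, False] @ replicate (k + 3) True @ [] \<in> W"
      by (rule word_closed_run[OF W, rotated 2]) auto
    then have "?r \<in> W" by simp
    moreover have "\<not> red_word ?r"
      by (rule not_red_wordI[where k=k]) (auto simp: peak_def nth_append nth_Cons' exceptional_words_def)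
    moreover have "\<not> const_word ?r" unfolding const_word_def by auto
    ultimately show False using bad[of ?r] by simp
  next
    case 2
    let ?r = "[f, True] @ replicate (k + 3) False @ [True]"
    have "[f, True] @ replicate (k + 4) False @ [True] \<in> W" using c cw 2 by simp
    then have "?r \<in> W" by (rule word_closed_run[OF W, rotated 2]) auto
    moreover have "\<not> red_word ?r"
      by (rule not_red_wordI[where k=k]) (auto simp: peak_def nth_append nth_Cons' exceptional_words_def)
    moreover have "\<not> const_word ?r" unfolding const_word_def by auto
    ultimately show False using bad[of ?r] by simp
  qed
qed

text \<open>The two preceding lemmas and their reflections exclude peaks in the two outermost places
  at each end. A peak in the third place on one side forces one on the other, and shortening the
  stretch between them leaves no peak in a position that makes a word red. Without these peaks
  \<open>butlast c\<close> and \<open>tl c\<close> have so few forms that their overlap is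
  contradictory unless \<open>c\<close> is constant.\<close>

lemma red_word_avoidable:
  assumes W: "word_closed W" and c: "c \<in> W" "length c = Suc l" "\<not> const_word c" and l: "l \<ge> 6"
  shows "\<exists>r\<in>W. length r = l \<and> \<not> const_word r \<and> \<not> red_word r"
proof (rule ccontr)
  assume "\<not> ?thesis"
  then have bad0: "const_word r \<or> red_word r" if "r \<in> W" "length r = l" for r using that by blast
  obtain k where k: "l = k + 6" using l by (metis add.commute le_Suc_ex)
  note bad = bad0[unfolded k]
  have lc: "length c = k + 7" using c k by simp
  have W': "word_closed (mirror ` W)" using W by (rule word_closed_mirror)
  have bad': "const_word r \<or> red_word r" if "r \<in> mirror ` W" "length r = k + 6" for r
    using that bad[of "mirror r"] red_word_mirror[of r] by (simp add: mem_mirror_image)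
  have c': "mirror c \<in> mirror ` W" "length (mirror c) = k + 7" using c lc by simp_all
  have p0: "\<not> peak c 0" by (rule no_escape_peak_0[OF W bad c(1) lc])
  have p1: "\<not> peak c 1" by (rule no_escape_peak_1[OF W bad c(1) lc])
  have "\<not> peak (mirror c) 0" by (rule no_escape_peak_0[OF W' bad' c'])
  then have p5: "\<not> peak c (k + 5)" using peak_mirror[of 0 c] lc by (simp add: add.commute)
  have "\<not> peak (mirror c) 1" by (rule no_escape_peak_1[OF W' bad' c'])
  then have p4: "\<not> peak c (k + 4)" using peak_mirror[of 1 c] lc by (simp add: add.commute)
  have nth1: "butlast c ! i = c ! i" if "i < k + 6" for i using that lc by (simp add: nth_butlast)
  have nth2: "tl c ! i = c ! Suc i" if "i < k + 6" for i using that lc by (simp add: nth_tl)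
  have peak1: "peak (butlast c) i = peak c i" if "i < k + 5" for i using that by (simp add: peak_def nth1)
  have peak2: "peak (tl c) i = peak c (Suc i)" if "i < k + 5" for i using that by (simp add: peak_def nth2)
  have len: "length (butlast c) = k + 6" "length (tl c) = k + 6" using lc by simp_all
  have mem: "butlast c \<in> W" "tl c \<in> W"
    using word_closed_butlast[OF W c(1)] word_closed_tl[OF W c(1)] by auto
  have ends: "\<not> peak (butlast c) 0" "\<not> peak (butlast c) (k + 4)" "\<not> peak (butlast c) 1"
    "\<not> peak (tl c) 0" "\<not> peak (tl c) (k + 4)" "\<not> peak (tl c) (k + 3)"
    using p0 p1 p4 p5 peak1[of 0] peak1[of 1] peak1[of "k + 4"] peak2[of 0] peak2[of "k + 3"] peak2[of "k + 4"]
    by (simp_all add: eval_nat_numeral)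
  \<comment> \<open>A peak makes \<open>r\<close> nonconstant and hence red. Special words have
    peaks only at the ends, so the red colour comes from position \<open>1\<close> or
    \<open>k + 3\<close>.\<close>
  have outer: "peak r 1 \<or> peak r (k + 3)"
    if r: "r \<in> W" "length r = k + 6" "\<not> peak r 0" "\<not> peak r (k + 4)" "peak r i" "i < k + 5" for r i
  proof -
    have "r ! i \<noteq> r ! Suc i" "Suc i < length r" using r by (auto simp: peak_def)
    then have "\<not> const_word r" unfolding const_word_nth by (meson Suc_lessD)
    then have "red_word r" using bad r by blast
    moreover have "\<not> (mirror r \<in> special_words (k + 6) \<or> r \<in> special_words (k + 6))"
      using special_words_peak[of r k i] r by metis
    ultimately show ?thesis using r(2) unfolding red_word_def Let_def by (auto simp: add.commute)
  qed
  have flat: "const_word r \<or> r = [False, False] @ replicate (k + 4) True \<or> r = replicate (k + 4) False @ [True, True]"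
    if r: "r \<in> W" "length r = k + 6" "\<not> peak r 0" "\<not> peak r (k + 4)" "\<not> peak r 1" "\<not> peak r (k + 3)" for r
  proof (cases "const_word r")
    case False
    then have "red_word r" using bad r by blast
    then have "mirror r \<in> special_words (k + 6) \<or> r \<in> special_words (k + 6)"
      using r(2,5,6) unfolding red_word_def Let_def by (auto simp: add.commute)
    then show ?thesis using r(3,4) unfolding special_words_iff
      by (elim disjE) (simp_all add: peak_def nth_append nth_Cons')
  qed simp
  show False
  proof (cases "peak c 2 \<or> peak c (k + 3)")
    case True
    have p2: "peak c 2"
    proof (rule ccontr)
      assume "\<not> peak c 2"
      then have "peak (tl c) (k + 2)" using True peak2[of "k + 2"] by (simp add: eval_nat_numeral)
      then have "peak (tl c) 1" using outer[OF mem(2) len(2), of "k + 2"] ends by simp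
      then show False using peak2[of 1] \<open>\<not> peak c 2\<close> by (simp add: numeral_2_eq_2)
    qed
    have p3: "peak c (k + 3)"
      using outer[OF mem(1) len(1), of 2] ends peak1[of 2] peak1[of "k + 3"] p2 by simp
    have k1: "k \<ge> 1" using p2 p3 by (cases k) (auto simp: peak_def numeral_3_eq_3 numeral_2_eq_2)
    obtain j where j: "k = Suc j" using k1 by (cases k) auto
    let ?u = "take j (drop 4 c)"
    \<comment> \<open>The stretch between the peaks at \<open>2\<close> and \<open>k + 3\<close>
      begins with a descent and ends with an ascent, as \<open>word_closed_shorten_ascent\<close>
      requires.\<close>
    have "c = [c ! 0, c ! 1, True] @ (False # ?u @ [True]) @ [False, c ! (j + 6), c ! (j + 7)]"
    proof (rule nth_equalityI)
      fix i assume i: "i < length c"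
      then consider "i < 4" | "4 \<le> i" "i < j + 4" | "i = j + 4" | "i = j + 5" | "i = j + 6" | "i = j + 7"
        using lc j by fastforce
      then show "c ! i = ([c ! 0, c ! 1, True] @ (False # ?u @ [True]) @ [False, c ! (j + 6), c ! (j + 7)]) ! i"
      proof cases
        case 1
        then have "i = 0 \<or> i = 1 \<or> i = 2 \<or> i = 3" by auto
        then show ?thesis using p2 by (auto simp: peak_def eval_nat_numeral)
      next
        case 2
        then obtain t where "i = 4 + t" "t < j" by (metis add_less_cancel_left add.commute le_Suc_ex)
        then show ?thesis using lc j by (simp add: nth_append nth_Cons')
      qed (use p3 lc j in \<open>simp_all add: peak_def nth_append nth_Cons' add.commute eval_nat_numeral\<close>)
    qed (use lc j in simp)
    then have "[c ! 0, c ! 1, True] @ (False # ?u @ [True]) @ [False, c ! (j + 6), c ! (j + 7)] \<in> W"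
      using c(1) by simp
    from word_closed_shorten_ascent[OF W this] obtain v where v: "length v = k"
      "[c ! 0, c ! 1, True] @ v @ [False, c ! (j + 6), c ! (j + 7)] \<in> W" using lc j by auto
    let ?r = "[c ! 0, c ! 1, True] @ v @ [False, c ! (j + 6), c ! (j + 7)]"
    have "\<not> red_word ?r"
      by (rule not_red_wordI[where k=k]) (use v(1) in \<open>auto simp: peak_def nth_append nth_Cons'\<close>)
    moreover have "\<not> const_word ?r" unfolding const_word_def by auto
    ultimately show False using bad[OF v(2)] v(1) by simp
  next
    case False
    then have "\<not> peak (butlast c) (k + 3)" "\<not> peak (tl c) 1"
      using peak1[of "k + 3"] peak2[of 1] by (simp_all add: numeral_2_eq_2)
    then consider "const_word (butlast c)" "const_word (tl c)"
      | "const_word (butlast c)" "tl c = [False, False] @ replicate (k + 4) True"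
      | "const_word (butlast c)" "tl c = replicate (k + 4) False @ [True, True]"
      | "butlast c = [False, False] @ replicate (k + 4) True" "const_word (tl c)"
      | "butlast c = [False, False] @ replicate (k + 4) True" "tl c = [False, False] @ replicate (k + 4) True"
      | "butlast c = [False, False] @ replicate (k + 4) True" "tl c = replicate (k + 4) False @ [True, True]"
      | "butlast c = replicate (k + 4) False @ [True, True]" "const_word (tl c)"
      | "butlast c = replicate (k + 4) False @ [True, True]" "tl c = [False, False] @ replicate (k + 4) True"
      | "butlast c = replicate (k + 4) False @ [True, True]" "tl c = replicate (k + 4) False @ [True, True]"
      using flat[OF mem(1) len(1)] flat[OF mem(2) len(2)] ends by blast
    moreover have eq1: "c ! i = c ! j" if "const_word (butlast c)" "i < k + 6" "j < k + 6" for i j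
      using that len nth1 unfolding const_word_nth by metis
    moreover have eq2: "c ! Suc i = c ! Suc j" if "const_word (tl c)" "i < k + 6" "j < k + 6" for i j
      using that len nth2 unfolding const_word_nth by metis
    moreover have False if "const_word (butlast c)" "const_word (tl c)"
    proof -
      have "c ! i = c ! 1" if "i < k + 7" for i
        using that eq1[of i 1] eq2[of "i - 1" 0] \<open>const_word (butlast c)\<close> \<open>const_word (tl c)\<close>
        by (cases i) auto
      then show False using c(3) lc unfolding const_word_nth by metis
    qed
    moreover have "c ! 1 = butlast c ! 1" "c ! 2 = butlast c ! 2" "c ! 3 = butlast c ! 3"
      "c ! (k + 4) = butlast c ! (k + 4)" by (simp_all add: nth1)
    moreover have "c ! 1 = tl c ! 0" "c ! 2 = tl c ! 1" "c ! 3 = tl c ! 2"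
      "c ! (k + 4) = tl c ! (k + 3)" "c ! (k + 5) = tl c ! (k + 4)"
      by (simp_all add: nth2 numeral_2_eq_2 numeral_3_eq_3 eval_nat_numeral)
    moreover have "c ! 1 = c ! (k + 4)" if "const_word (tl c)"
      using eq2[OF that, of 0 "k + 3"] by (simp add: eval_nat_numeral)
    ultimately show False
      using eq1[of 1 2] eq1[of 2 3] eq1[of "k + 4" "k + 5"] eq2[of 0 1]
      by cases (simp_all add: nth_append nth_Cons' numeral_2_eq_2 numeral_3_eq_3)
  qed
qed

section \<open>Binary branching levels\<close>

text \<open>One operator serves for the levels of a vertex list, with \<open>split_level\<close>,
  and for the word of a level list, with \<open>(<)\<close>.\<close>

fun consecutive :: "('a \<Rightarrow> 'a \<Rightarrow> 'b) \<Rightarrow> 'a list \<Rightarrow> 'b list" where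
  "consecutive f (x # y # zs) = f x y # consecutive f (y # zs)"
| "consecutive f _ = []"

lemma consecutive_append:
  "consecutive f (us @ p # ws) = consecutive f (us @ [p]) @ consecutive f (p # ws)"
  by (induction f us rule: consecutive.induct) auto

lemma length_consecutive [simp]: "length (consecutive f xs) = length xs - 1"
  by (induction f xs rule: consecutive.induct) auto

lemma consecutive_tl: "consecutive f (tl xs) = tl (consecutive f xs)"
  by (cases "(f, xs)" rule: consecutive.cases) auto

lemma consecutive_butlast: "consecutive f (butlast xs) = butlast (consecutive f xs)"
proof (induction f xs rule: consecutive.induct)
  case (1 f x y zs)
  then show ?case by (cases zs) auto
qed auto

lemma consecutive_eq_appendE:
  assumes "consecutive f xs = as @ y # bs"
  obtains us p q ws where "xs = us @ p # q # ws" "consecutive f (us @ [p]) = as" "y = f p q"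
    "consecutive f (q # ws) = bs"
proof -
  have "\<exists>us p q ws. xs = us @ p # q # ws \<and> consecutive f (us @ [p]) = as \<and> y = f p q \<and>
    consecutive f (q # ws) = bs"
    using assms
  proof (induction as arbitrary: xs)
    case Nil
    then show ?case by (cases "(f, xs)" rule: consecutive.cases) (auto intro: exI[of _ "[]"])
  next
    case (Cons a as)
    then obtain x x' zs where xs: "xs = x # x' # zs" "a = f x x'" "consecutive f (x' # zs) = as @ y # bs"
      by (cases "(f, xs)" rule: consecutive.cases) auto
    from Cons.IH[OF xs(3)] obtain us p q ws where
      "x' # zs = us @ p # q # ws" "consecutive f (us @ [p]) = as" "y = f p q" "consecutive f (q # ws) = bs"
      by blast
    then show ?case using xs
      by (intro exI[of _ "x # us"] exI[of _ p] exI[of _ q] exI[of _ ws]) (cases us; auto)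
  qed
  then show ?thesis using that by blast
qed

text \<open>This is the highest binary digit at which \<open>u\<close> and \<open>v\<close> differ, if \<open>u \<noteq> v\<close>.\<close>

definition split_level :: "nat \<Rightarrow> nat \<Rightarrow> nat" where
  "split_level u v = (LEAST j. u div 2 ^ Suc j = v div 2 ^ Suc j)"

text \<open>Quotients that agree at one level agree at all higher ones, so the least level of
  agreement determines them all. Statements about levels thus become statements about
  quotients.\<close>

lemma split_level_le_iff: "split_level u v \<le> j \<longleftrightarrow> u div 2 ^ Suc j = v div 2 ^ Suc j"
proof
  have mono: "u div 2 ^ j = v div 2 ^ j" if eq: "u div 2 ^ i = v div 2 ^ i" and le: "i \<le> j" for i j :: nat
  proof -
    obtain d where "j = i + d" using le le_Suc_ex by blast
    then show ?thesis using eq by (simp add: power_add div_mult2_eq)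
  qed
  have "u div 2 ^ Suc (u + v) = v div 2 ^ Suc (u + v)"
  proof -
    have "u < 2 ^ Suc (u + v)" "v < 2 ^ Suc (u + v)"
      by (rule order.strict_trans1[OF _ less_exp]; simp)+
    then show ?thesis by simp
  qed
  then have "u div 2 ^ Suc (split_level u v) = v div 2 ^ Suc (split_level u v)"
    unfolding split_level_def by (rule LeastI)
  then show "split_level u v \<le> j \<Longrightarrow> u div 2 ^ Suc j = v div 2 ^ Suc j"
    using mono by (metis Suc_le_mono)
next
  show "u div 2 ^ Suc j = v div 2 ^ Suc j \<Longrightarrow> split_level u v \<le> j"
    unfolding split_level_def by (rule Least_le)
qed

lemma split_level_max:
  assumes "u \<le> v" "v \<le> w"
  shows "split_level u w = max (split_level u v) (split_level v w)"
proof -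
  have "split_level u w \<le> j \<longleftrightarrow> max (split_level u v) (split_level v w) \<le> j" for j
  proof -
    have "u div 2 ^ Suc j \<le> v div 2 ^ Suc j" "v div 2 ^ Suc j \<le> w div 2 ^ Suc j"
      using assms by (simp_all only: div_le_mono)
    then show ?thesis unfolding max.bounded_iff split_level_le_iff by linarith
  qed
  then show ?thesis by (metis order_antisym order_refl)
qed

text \<open>At a common level \<open>j\<close> the three quotients by \<open>2 ^ j\<close> would be
  different but have the same half, and only two numbers share a half.\<close>

lemma split_level_neq:
  assumes "u < v" "v < w"
  shows "split_level u v \<noteq> split_level v w"
proof
  assume eq: "split_level u v = split_level v w"
  define j where "j = split_level u v"
  have same: "u div 2 ^ Suc j = v div 2 ^ Suc j" "v div 2 ^ Suc j = w div 2 ^ Suc j"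
    using split_level_le_iff[of u v j] split_level_le_iff[of v w j] eq by (simp_all add: j_def)
  have "u div 2 ^ j \<noteq> v div 2 ^ j" "v div 2 ^ j \<noteq> w div 2 ^ j"
  proof -
    have "x div 2 ^ j \<noteq> y div 2 ^ j" if "split_level x y = j" "x < y" for x y
    proof (cases j)
      case (Suc i)
      then show ?thesis using split_level_le_iff[of x y i] that by auto
    qed (use that in auto)
    from this[of u v] this[of v w] show "u div 2 ^ j \<noteq> v div 2 ^ j" "v div 2 ^ j \<noteq> w div 2 ^ j"
      using eq assms by (simp_all add: j_def)
  qed
  moreover have "u div 2 ^ j \<le> v div 2 ^ j" "v div 2 ^ j \<le> w div 2 ^ j"
    using assms by (simp_all add: div_le_mono)
  ultimately have "u div 2 ^ j < v div 2 ^ j" "v div 2 ^ j < w div 2 ^ j" by simp_all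
  moreover have "(u div 2 ^ j) div 2 = (w div 2 ^ j) div 2"
    using same by (simp only: power_Suc2 div_mult2_eq)
  moreover have False if "a < b" "b < c" "a div 2 = c div 2" for a b c :: nat
    using that by presburger
  ultimately show False by blast
qed

lemma split_level_less:
  assumes "u < v" "v < 2 ^ N"
  shows "split_level u v < N"
proof (cases N)
  case (Suc M)
  have "split_level u v \<le> M" unfolding split_level_le_iff using assms Suc by simp
  then show ?thesis using Suc by simp
qed (use assms in auto)

abbreviation deltas :: "nat list \<Rightarrow> nat list" where
  "deltas \<equiv> consecutive split_level"

abbreviation ascents :: "nat list \<Rightarrow> bool list" where
  "ascents \<equiv> consecutive (<)"

definition delta_lists :: "nat set \<Rightarrow> nat list set" where
  "delta_lists X = {deltas vs | vs. sorted_wrt (<) vs \<and> set vs \<subseteq> X}"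

lemma delta_listsI: "sorted_wrt (<) vs \<Longrightarrow> set vs \<subseteq> X \<Longrightarrow> deltas vs \<in> delta_lists X"
  unfolding delta_lists_def by blast

lemma delta_lists_tl:
  assumes "d \<in> delta_lists X" shows "tl d \<in> delta_lists X"
proof -
  obtain vs where vs: "d = deltas vs" "sorted_wrt (<) vs" "set vs \<subseteq> X"
    using assms by (auto simp: delta_lists_def)
  have "sorted_wrt (<) (tl vs)" "set (tl vs) \<subseteq> X"
    using vs by (cases vs; auto)+
  then show ?thesis using delta_listsI[of "tl vs"] vs(1) by (simp add: consecutive_tl)
qed

lemma delta_lists_butlast:
  assumes "d \<in> delta_lists X" shows "butlast d \<in> delta_lists X"
proof -
  obtain vs where vs: "d = deltas vs" "sorted_wrt (<) vs" "set vs \<subseteq> X"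
    using assms by (auto simp: delta_lists_def)
  have "sorted_wrt (<) (butlast vs)" "set (butlast vs) \<subseteq> X"
    using vs by (cases vs rule: rev_cases; auto simp: sorted_wrt_append)+
  then show ?thesis using delta_listsI[of "butlast vs"] vs(1) by (simp add: consecutive_butlast)
qed

lemma delta_lists_adjacent:
  assumes "xs @ a # b # ys \<in> delta_lists X" shows "a \<noteq> b"
proof -
  obtain vs where vs: "xs @ a # b # ys = deltas vs" "sorted_wrt (<) vs"
    using assms by (auto simp: delta_lists_def)
  obtain us p q ws where 1: "vs = us @ p # q # ws" "deltas (us @ [p]) = xs" "a = split_level p q"
    "deltas (q # ws) = b # ys" by (rule consecutive_eq_appendE[OF vs(1)[symmetric]])
  then obtain r ws' where "ws = r # ws'" "b = split_level q r" by (cases ws) auto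
  then show ?thesis using 1 vs(2) split_level_neq[of p q r] by (auto simp: sorted_wrt_append)
qed

text \<open>Omitting a vertex replaces two adjacent levels by their maximum.\<close>

lemma delta_lists_omit:
  assumes "xs @ a # b # c # ys \<in> delta_lists X" "b < max a c"
  shows "xs @ a # c # ys \<in> delta_lists X"
proof -
  obtain vs where vs: "xs @ a # b # c # ys = deltas vs" "sorted_wrt (<) vs" "set vs \<subseteq> X"
    using assms by (auto simp: delta_lists_def)
  obtain us p q ws where 1: "vs = us @ p # q # ws" "deltas (us @ [p]) = xs" "a = split_level p q"
    "deltas (q # ws) = b # c # ys" by (rule consecutive_eq_appendE[OF vs(1)[symmetric]])
  then obtain r ws' where 2: "ws = r # ws'" "b = split_level q r" "deltas (r # ws') = c # ys"
    by (cases ws) auto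
  then obtain s ws'' where 3: "ws' = s # ws''" "c = split_level r s" "deltas (s # ws'') = ys"
    by (cases ws') auto
  have ord: "p < q" "q < r" "r < s" using vs(2) 1 2 3 by (auto simp: sorted_wrt_append)
  show ?thesis
  proof (cases "b < a")
    case True
    have "deltas (us @ p # r # s # ws'') = xs @ a # c # ys"
      using True ord 1 2 3 split_level_max[of p q r]
      by (subst consecutive_append) simp
    moreover have "sorted_wrt (<) (us @ p # r # s # ws'')" "set (us @ p # r # s # ws'') \<subseteq> X"
      using vs(2,3) unfolding 1 2 3 by (auto simp: sorted_wrt_append)
    ultimately show ?thesis using delta_listsI by metis
  next
    case False
    then have "b < c" using assms(2) by auto
    then have "deltas (us @ p # q # s # ws'') = xs @ a # c # ys"
      using ord 1 2 3 split_level_max[of q r s]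
      by (subst consecutive_append) simp
    moreover have "sorted_wrt (<) (us @ p # q # s # ws'')" "set (us @ p # q # s # ws'') \<subseteq> X"
      using vs(2,3) unfolding 1 2 3 by (auto simp: sorted_wrt_append)
    ultimately show ?thesis using delta_listsI by metis
  qed
qed

text \<open>Two equal letters, like a valley, put the middle level below one of its neighbours, so
  it can be omitted. The neighbours compare as before in the first case and in an unknown way in the
  second.\<close>

lemma word_closed_ascents: "word_closed (ascents ` delta_lists X)"
  unfolding word_closed_def
proof (intro conjI ballI allI impI)
  fix c assume "c \<in> ascents ` delta_lists X"
  then obtain d where "c = ascents d" "d \<in> delta_lists X" by blast
  then show "tl c \<in> ascents ` delta_lists X" "butlast c \<in> ascents ` delta_lists X"
    using delta_lists_tl delta_lists_butlast consecutive_tl consecutive_butlast by (metis imageI)+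
next
  have *: "\<exists>a b c xs ys. xs @ a # b # c # ys \<in> delta_lists X \<and> x = (a < b) \<and> y = (b < c) \<and>
     ps = ascents (xs @ [a]) \<and> qs = ascents (c # ys)"
    if mem: "ps @ [x, y] @ qs \<in> ascents ` delta_lists X" for ps x y qs
  proof -
    obtain d where d: "ascents d = ps @ x # (y # qs)" "d \<in> delta_lists X" using mem by auto
    obtain us p q ws where
      1: "d = us @ p # q # ws" "ascents (us @ [p]) = ps" "x = (p < q)" "ascents (q # ws) = y # qs"
      by (rule consecutive_eq_appendE[OF d(1)])
    then obtain r ws' where "ws = r # ws'" "y = (q < r)" "ascents (r # ws') = qs" by (cases ws) auto
    then show ?thesis using 1 d(2) by blast
  qed
  have app: "ascents (xs @ a # c # ys) = ascents (xs @ [a]) @ [a < c] @ ascents (c # ys)" for xs a c ys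
    by (subst consecutive_append) simp
  {
    fix ps x qs assume "ps @ [x, x] @ qs \<in> ascents ` delta_lists X"
    then obtain a b c xs ys where abc: "xs @ a # b # c # ys \<in> delta_lists X" "x = (a < b)" "x = (b < c)"
      "ps = ascents (xs @ [a])" "qs = ascents (c # ys)" using *[of ps x x qs] by blast
    have "a \<noteq> b" "b \<noteq> c"
      using delta_lists_adjacent[of xs a b "c # ys"] delta_lists_adjacent[of "xs @ [a]" b c ys] abc(1) by auto
    then have "b < max a c" "x = (a < c)" using abc(2,3) by auto
    then have "ps @ [x] @ qs = ascents (xs @ a # c # ys)" "xs @ a # c # ys \<in> delta_lists X"
      using delta_lists_omit[OF abc(1)] abc(4,5) unfolding app by simp_all
    then show "ps @ [x] @ qs \<in> ascents ` delta_lists X" by simp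
  }
  fix ps qs assume "ps @ [False, True] @ qs \<in> ascents ` delta_lists X"
  then obtain a b c xs ys where abc: "xs @ a # b # c # ys \<in> delta_lists X" "\<not> a < b" "b < c"
    "ps = ascents (xs @ [a])" "qs = ascents (c # ys)" using *[of ps False True qs] by blast
  then have "b < max a c" by auto
  then have "ps @ [a < c] @ qs = ascents (xs @ a # c # ys)" "xs @ a # c # ys \<in> delta_lists X"
    using delta_lists_omit[OF abc(1)] abc(4,5) unfolding app by simp_all
  then show "\<exists>z. ps @ [z] @ qs \<in> ascents ` delta_lists X" by (metis imageI)
qed

definition monotone_list :: "nat list \<Rightarrow> bool" where
  "monotone_list d \<longleftrightarrow> sorted_wrt (<) d \<or> sorted_wrt (>) d"

text \<open>A letter \<open>False\<close> only says that the level does not increase; strict descent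
  comes from \<open>delta_lists_adjacent\<close>.\<close>

lemma const_word_ascents:
  assumes "d \<in> delta_lists X"
  shows "const_word (ascents d) \<longleftrightarrow> monotone_list d"
proof
  assume "const_word (ascents d)"
  then obtain x where x: "set (ascents d) \<subseteq> {x}" unfolding const_word_def by blast
  show "monotone_list d"
  proof (cases x)
    case True
    have "set (ascents d) \<subseteq> {True} \<Longrightarrow> sorted_wrt (<) d" for d :: "nat list"
      by (induction "(<) :: nat \<Rightarrow> nat \<Rightarrow> bool" d rule: consecutive.induct) (auto intro: less_trans)
    then show ?thesis using x True unfolding monotone_list_def by blast
  next
    case False
    have "set (ascents d) \<subseteq> {False} \<Longrightarrow> set (consecutive (\<noteq>) d) \<subseteq> {True} \<Longrightarrow> sorted_wrt (>) d"
      for d :: "nat list"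
    proof (induction "(<) :: nat \<Rightarrow> nat \<Rightarrow> bool" d rule: consecutive.induct)
      case (1 x y zs)
      then have "sorted_wrt (>) (y # zs)" "y < x" by auto
      then show ?case by (auto intro: less_trans)
    qed auto
    moreover have "set (consecutive (\<noteq>) d) \<subseteq> {True}"
    proof
      fix y assume "y \<in> set (consecutive (\<noteq>) d)"
      then obtain as bs where "consecutive (\<noteq>) d = as @ y # bs" by (metis split_list)
      then obtain us p q ws where "d = us @ p # q # ws" "y = (p \<noteq> q)" by (rule consecutive_eq_appendE)
      then show "y \<in> {True}" using delta_lists_adjacent assms by blast
    qed
    ultimately have "sorted_wrt (>) d" using x False by simp
    then show ?thesis unfolding monotone_list_def by blast
  qed
next
  assume "monotone_list d"
  moreover have "sorted_wrt (<) d \<Longrightarrow> set (ascents d) \<subseteq> {True}" for d :: "nat list"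
    by (induction "(<) :: nat \<Rightarrow> nat \<Rightarrow> bool" d rule: consecutive.induct) auto
  moreover have "sorted_wrt (>) d \<Longrightarrow> set (ascents d) \<subseteq> {False}" for d :: "nat list"
    by (induction "(<) :: nat \<Rightarrow> nat \<Rightarrow> bool" d rule: consecutive.induct) auto
  ultimately show "const_word (ascents d)" unfolding monotone_list_def const_word_def by blast
qed

text \<open>Every inner level of a monotone list is below one of its neighbours and end levels go
  with an end vertex, so unwanted levels can be removed one at a time.\<close>

lemma delta_lists_monotone_subset:
  assumes "d \<in> delta_lists X" "monotone_list d" "S \<subseteq> set d"
  shows "\<exists>d'\<in>delta_lists X. monotone_list d' \<and> set d' = S"
  using assms
proof (induction "length d" arbitrary: d)
  case 0
  then show ?case by auto
next
  case (Suc n)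
  show ?case
  proof (cases "set d = S")
    case True
    then show ?thesis using Suc by blast
  next
    case False
    then obtain x where x: "x \<in> set d" "x \<notin> S" using Suc.prems by blast
    then obtain xs ys where d: "d = xs @ x # ys" by (metis split_list)
    have m: "monotone_list (xs @ ys)" using Suc.prems(2) unfolding d monotone_list_def
      by (auto simp: sorted_wrt_append)
    have "xs @ ys \<in> delta_lists X"
    proof (cases "xs = [] \<or> ys = []")
      case True
      then show ?thesis using delta_lists_tl[OF Suc.prems(1)] delta_lists_butlast[OF Suc.prems(1)] d
        by (auto simp: butlast_append)
    next
      case False
      then obtain us a b vs where ab: "xs = us @ [a]" "ys = b # vs"
        by (metis append_butlast_last_id neq_Nil_conv)
      have "x < max a b" using Suc.prems(2) unfolding d ab monotone_list_def
        by (auto simp: sorted_wrt_append)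
      then show ?thesis using delta_lists_omit[of us a x b vs X] Suc.prems(1) d ab by simp
    qed
    moreover have "S \<subseteq> set (xs @ ys)" using Suc.prems(3) x d by auto
    moreover have "n = length (xs @ ys)" using Suc.hyps(2) d by simp
    ultimately show ?thesis using Suc.hyps(1) m by blast
  qed
qed

lemma monotone_list_distinct: "monotone_list d \<Longrightarrow> distinct d"
proof -
  have "sorted_wrt (<) d \<or> sorted_wrt (>) d \<Longrightarrow> distinct d" for d :: "nat list"
    by (induction d) auto
  then show "monotone_list d \<Longrightarrow> distinct d" unfolding monotone_list_def .
qed

section \<open>Stepping up\<close>

text \<open>With three or more letters \<open>tl c\<close> and \<open>butlast c\<close> overlap, so
  they are not both constant unless \<open>c\<close> is.\<close>

lemma word_closed_nonconst_factor:
  assumes W: "word_closed W" and "k \<ge> 2"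
  shows "c \<in> W \<Longrightarrow> \<not> const_word c \<Longrightarrow> length c \<ge> k \<Longrightarrow> \<exists>r\<in>W. length r = k \<and> \<not> const_word r"
proof (induction "length c - k" arbitrary: c)
  case 0
  then show ?case by (intro bexI[of _ c]) auto
next
  case (Suc n)
  have len: "length c \<ge> 3" using Suc.hyps(2) assms(2) by simp
  then obtain f g h hs where fgh: "c = f # g # h # hs"
    by (cases c; cases "tl c"; cases "tl (tl c)") auto
  define mid e where "mid = butlast (h # hs)" and "e = last (h # hs)"
  have c: "c = f # g # mid @ [e]" unfolding fgh mid_def e_def by simp
  have "\<not> const_word (tl c) \<or> \<not> const_word (butlast c)"
  proof (rule ccontr)
    assume "\<not> ?thesis"
    then obtain x y where "set (tl c) \<subseteq> {x}" "set (butlast c) \<subseteq> {y}" unfolding const_word_def by blast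
    then have "set c \<subseteq> {g}" unfolding c by auto
    then show False using Suc.prems(2) unfolding const_word_def by blast
  qed
  moreover have "tl c \<in> W" "butlast c \<in> W"
    using word_closed_tl[OF W] word_closed_butlast[OF W] Suc.prems(1) by blast+
  moreover have "n = length (tl c) - k" "n = length (butlast c) - k" "length (tl c) \<ge> k" "length (butlast c) \<ge> k"
    using Suc.hyps(2) by simp_all
  ultimately show ?case using Suc.hyps(1)[of "tl c"] Suc.hyps(1)[of "butlast c"] by blast
qed

lemma delta_list_of_set:
  assumes "d \<in> delta_lists X" "d \<noteq> []"
  obtains Y where "Y \<subseteq> X" "finite Y" "card Y = Suc (length d)" "deltas (sorted_list_of_set Y) = d"
proof -
  obtain vs where vs: "d = deltas vs" "sorted_wrt (<) vs" "set vs \<subseteq> X"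
    using assms by (auto simp: delta_lists_def)
  have sd: "sorted vs" "distinct vs" using vs(2) strict_sorted_iff by blast+
  have "sorted_list_of_set (set vs) = vs" "card (set vs) = length vs"
    using sorted_list_of_set.idem_if_sorted_distinct[OF sd] distinct_card[OF sd(2)] by blast+
  moreover have "length vs = Suc (length d)"
    using vs(1) assms(2) by (cases vs) simp_all
  ultimately have "card (set vs) = Suc (length d)" "deltas (sorted_list_of_set (set vs)) = d"
    using vs(1) by metis+
  then show ?thesis using that[of "set vs"] vs(3) by blast
qed

lemma delta_lists_bounded:
  assumes "d \<in> delta_lists X" "X \<subseteq> {..<2 ^ N}"
  shows "set d \<subseteq> {..<N}"
proof
  fix y assume "y \<in> set d"
  obtain vs where vs: "d = deltas vs" "sorted_wrt (<) vs" "set vs \<subseteq> X"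
    using assms by (auto simp: delta_lists_def)
  obtain as bs where "deltas vs = as @ y # bs" using split_list[OF \<open>y \<in> set d\<close>] vs(1) by auto
  then obtain us p q ws where "vs = us @ p # q # ws" "y = split_level p q"
    by (rule consecutive_eq_appendE)
  moreover from this have "p < q" "q < 2 ^ N" using vs assms(2) by (auto simp: sorted_wrt_append)
  ultimately show "y \<in> {..<N}" using split_level_less by simp
qed

lemma monotone_subset_of_set:
  assumes d: "d \<in> delta_lists X" "monotone_list d" and S: "S \<subseteq> set d" "S \<noteq> {}"
  obtains Y where "Y \<subseteq> X" "finite Y" "card Y = Suc (card S)"
    "monotone_list (deltas (sorted_list_of_set Y))" "set (deltas (sorted_list_of_set Y)) = S"
proof -
  obtain d' where d': "d' \<in> delta_lists X" "monotone_list d'" "set d' = S"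
    using delta_lists_monotone_subset[OF d S(1)] by blast
  have "card S = length d'" using d'(3) distinct_card[OF monotone_list_distinct[OF d'(2)]] by simp
  moreover have "d' \<noteq> []" using d'(3) S(2) by auto
  then obtain Y where "Y \<subseteq> X" "finite Y" "card Y = Suc (length d')" "deltas (sorted_list_of_set Y) = d'"
    by (rule delta_list_of_set[OF d'(1)])
  ultimately show ?thesis using that[of Y] d'(2,3) by simp
qed

lemma deltas_of_set_mem: "finite X \<Longrightarrow> deltas (sorted_list_of_set X) \<in> delta_lists X"
  by (rule delta_listsI) auto

lemma not_partn_lst_2E:
  assumes "\<not> partn_lst A [s, n] k"
  obtains f where "f \<in> nsets A k \<rightarrow> {..<2 :: nat}"
    "\<And>H. H \<in> nsets A s \<Longrightarrow> \<not> f ` nsets H k \<subseteq> {0}"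
    "\<And>H. H \<in> nsets A n \<Longrightarrow> \<not> f ` nsets H k \<subseteq> {1}"
proof -
  obtain f where f: "f \<in> nsets A k \<rightarrow> {..<length [s, n]}"
    "\<not> (\<exists>\<xi><length [s, n]. \<exists>H\<in>nsets A ([s, n] ! \<xi>). f ` nsets H k \<subseteq> {\<xi>})"
    using assms unfolding partn_lst_def monochromatic_def by blast
  have "\<not> f ` nsets H k \<subseteq> {0}" if "H \<in> nsets A s" for H
    using f(2) that by (auto dest!: spec[of _ 0])
  moreover have "\<not> f ` nsets H k \<subseteq> {1}" if "H \<in> nsets A n" for H
    using f(2) that by (auto dest!: spec[of _ 1])
  ultimately show ?thesis using that[of f] f(1) by (simp add: numeral_2_eq_2)
qed

text \<open>The stepping-up colouring: a set with monotone delta list gets the colour of the set of its levels,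
  any other set is red iff the predicate \<open>R\<close> holds of the ascent word of its delta list.\<close>

lemma stepping_up:
  fixes R :: "bool list \<Rightarrow> bool"
  assumes avoidable: "\<And>W c. word_closed W \<Longrightarrow> c \<in> W \<Longrightarrow> length c = k \<Longrightarrow> \<not> const_word c \<Longrightarrow>
      \<exists>r\<in>W. length r = k - 1 \<and> \<not> const_word r \<and> \<not> R r"
    and unavoidable: "\<And>W c. word_closed W \<Longrightarrow> c \<in> W \<Longrightarrow> length c = n' - 2 \<Longrightarrow>
      (\<exists>r\<in>W. length r = k - 1 \<and> \<not> const_word r \<and> R r) \<or> (\<exists>r\<in>W. length r = n - 1 \<and> const_word r)"
    and small: "\<not> partn_lst {..<N} [s, n] k"
    and bounds: "k \<ge> 2" "s > k" "n \<ge> 2" "n' \<ge> 2"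
  shows "\<not> partn_lst {..<2 ^ N :: nat} [Suc s, n'] (Suc k)"
proof
  assume big: "partn_lst {..<2 ^ N :: nat} [Suc s, n'] (Suc k)"
  obtain f :: "nat set \<Rightarrow> nat" where f: "f \<in> nsets {..<N} k \<rightarrow> {..<2}"
    and nf: "\<And>H. H \<in> nsets {..<N} s \<Longrightarrow> \<not> f ` nsets H k \<subseteq> {0}"
      "\<And>H. H \<in> nsets {..<N} n \<Longrightarrow> \<not> f ` nsets H k \<subseteq> {1}"
    by (rule not_partn_lst_2E[OF small], rule that; blast)
  define D where "D X = deltas (sorted_list_of_set X)" for X :: "nat set"
  define g where "g X = (if monotone_list (D X) then f (set (D X))
    else if R (ascents (D X)) then 0 else 1)" for X :: "nat set"
  have D: "D X \<in> delta_lists X" "length (D X) = card X - 1" if "finite X" for X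
    using deltas_of_set_mem[OF that] that by (auto simp: D_def)
  have set_D: "set (D X) \<in> nsets {..<N} (card X - 1)"
    if "finite X" "X \<subseteq> {..<2 ^ N}" "monotone_list (D X)" for X
    using delta_lists_bounded[OF D(1)[OF that(1)] that(2)] D(2)[OF that(1)]
      distinct_card[OF monotone_list_distinct[OF that(3)]] by (simp add: nsets_def)
  have "g \<in> nsets {..<2 ^ N} (Suc k) \<rightarrow> {..<2}"
  proof
    fix X assume X: "X \<in> nsets {..<2 ^ N :: nat} (Suc k)"
    then have "set (D X) \<in> nsets {..<N} k" if "monotone_list (D X)"
      using set_D[of X] that by (auto simp: nsets_def)
    then show "g X \<in> {..<2}" using f by (auto simp: g_def)
  qed
  then have "g \<in> nsets {..<2 ^ N} (Suc k) \<rightarrow> {..<length [Suc s, n']}" by (simp add: numeral_2_eq_2)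
  from bspec[OF big[unfolded partn_lst_def monochromatic_def] this] obtain i H where
    "i < length [Suc s, n']" and iH: "H \<in> nsets {..<2 ^ N} ([Suc s, n'] ! i)" "g ` nsets H (Suc k) \<subseteq> {i}"
    by blast
  then have i2: "i < 2" by simp
  have H: "finite H" "H \<subseteq> {..<2 ^ N}" "card H = [Suc s, n'] ! i" using iH(1) by (auto simp: nsets_def)
  let ?W = "ascents ` delta_lists H"
  have W: "word_closed ?W" by (rule word_closed_ascents)
  define c where "c = ascents (D H)"
  have cW: "c \<in> ?W" using D(1)[OF H(1)] by (auto simp: c_def)
  have len_c: "length c = card H - 2" using D(2)[OF H(1)] by (simp add: c_def)
  \<comment> \<open>A word of \<open>k - 1\<close> letters belongs to \<open>k\<close> levels and
    hence to \<open>k + 1\<close> vertices.\<close>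
  have colour: "R r \<longleftrightarrow> i = 0" if r: "r \<in> ?W" "length r = k - 1" "\<not> const_word r" for r
  proof -
    obtain d where d: "d \<in> delta_lists H" "r = ascents d" using r(1) by blast
    have "length d - 1 = k - 1" using d(2) r(2) by simp
    moreover have "k - 1 \<ge> 1" using bounds(1) by simp
    ultimately have len: "length d = k" by linarith
    then have ne: "d \<noteq> []" using bounds(1) by auto
    obtain Y where Y: "Y \<subseteq> H" "finite Y" "card Y = Suc (length d)" "deltas (sorted_list_of_set Y) = d"
      by (rule delta_list_of_set[OF d(1) ne])
    then have "Y \<in> nsets H (Suc k)" using len by (simp add: nsets_def)
    then have "g Y = i" using iH(2) by blast
    moreover have "\<not> monotone_list (D Y)" using const_word_ascents[OF d(1)] r(3) d(2) Y(4) by (simp add: D_def)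
    ultimately show ?thesis unfolding g_def D_def Y(4) d(2) by (auto split: if_splits)
  qed
  \<comment> \<open>Every \<open>k\<close>-set of levels of a monotone list is the level set of some
    \<open>k + 1\<close> vertices of \<open>H\<close>, so the smaller colouring is constant on these
    levels.\<close>
  have mono: "f ` nsets (set d) k \<subseteq> {i}" if d: "d \<in> delta_lists H" "monotone_list d" for d
  proof clarify
    fix S assume S: "S \<in> nsets (set d) k"
    then have "S \<noteq> {}" "S \<subseteq> set d" using bounds(1) by (auto simp: nsets_def)
    then obtain Y where Y: "Y \<subseteq> H" "finite Y" "card Y = Suc (card S)"
      "monotone_list (D Y)" "set (D Y) = S"
      using monotone_subset_of_set[OF d] unfolding D_def by metis
    then have "Y \<in> nsets H (Suc k)" using S by (simp add: nsets_def)
    then have "g Y = i" using iH(2) by blast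
    then show "f S = i" using Y by (simp add: g_def)
  qed
  show False
  proof (cases "i = 0")
    case True
    then have card: "card H = Suc s" using H by simp
    \<comment> \<open>A nonconstant word would contain one of exactly \<open>k\<close> letters, and
      \<open>avoidable\<close> would find a blue set below it.\<close>
    have "const_word c"
    proof (rule ccontr)
      assume "\<not> const_word c"
      moreover have "length c \<ge> k" using len_c card bounds by simp
      ultimately obtain r where "r \<in> ?W" "length r = k" "\<not> const_word r"
        using word_closed_nonconst_factor[OF W bounds(1) cW] by blast
      then show False using avoidable[OF W] colour True by blast
    qed
    then have m: "monotone_list (D H)" using const_word_ascents[OF D(1)[OF H(1)]] by (simp add: c_def)
    have "set (D H) \<in> nsets {..<N} s" using set_D[OF H(1,2) m] card by simp
    then show False using nf(1) mono[OF D(1)[OF H(1)] m] True by blast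
  next
    case False
    then have i: "i = 1" using i2 by simp
    then have "length c = n' - 2" using len_c H(3) by simp
    with unavoidable[OF W cW] colour i obtain r where r: "r \<in> ?W" "length r = n - 1" "const_word r" by fastforce
    then obtain d where d: "d \<in> delta_lists H" "r = ascents d" by blast
    have m: "monotone_list d" using const_word_ascents[OF d(1)] d(2) r(3) by simp
    have "length d = n" using d(2) r(2) bounds(3) by simp
    then have "set d \<in> nsets {..<N} n"
      using delta_lists_bounded[OF d(1) H(2)] distinct_card[OF monotone_list_distinct[OF m]]
      by (simp add: nsets_def)
    then show False using nf(2) mono[OF d(1) m] i by blast
  qed
qed

section \<open>The sharp and the simple stepping-up rule\<close>

lemma stepping_up_strong:
  assumes "\<not> partn_lst {..<N} [s, n] k" "k \<ge> 7" "s > k" "n \<ge> 2 * k"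
  shows "\<not> partn_lst {..<2 ^ N :: nat} [Suc s, n + 2] (Suc k)"
proof (rule stepping_up[where R = red_word, OF _ _ assms(1)])
  fix W c assume "word_closed W" "c \<in> W" "length c = k" "\<not> const_word c"
  then show "\<exists>r\<in>W. length r = k - 1 \<and> \<not> const_word r \<and> \<not> red_word r"
    using red_word_avoidable[of W c "k - 1"] assms(2) by simp
next
  fix W c assume c: "word_closed W" "c \<in> W" "length c = n + 2 - 2"
  show "(\<exists>r\<in>W. length r = k - 1 \<and> \<not> const_word r \<and> red_word r) \<or> (\<exists>r\<in>W. length r = n - 1 \<and> const_word r)"
  \<comment> \<open>If dropping one end letter leaves a constant word, its \<open>n - 1\<close>
    letters come from \<open>n\<close> monotone levels. Otherwise \<open>n \<ge> 2 * k\<close>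
    leaves enough letters to reach a red word.\<close>
  proof (cases "const_word (tl c) \<or> const_word (butlast c)")
    case True
    moreover have "tl c \<in> W" "butlast c \<in> W" "length (tl c) = n - 1" "length (butlast c) = n - 1"
      using word_closed_tl[OF c(1,2)] word_closed_butlast[OF c(1,2)] c(3) by simp_all
    ultimately show ?thesis by blast
  next
    case False
    then have "\<exists>r\<in>W. length r = k - 1 \<and> red_word r"
      using c assms(2,4) by (intro red_word_unavoidable) auto
    then show ?thesis using red_word_not_const assms(2) by fastforce
  qed
qed (use assms in auto)

lemma not_const_word_iff: "\<not> const_word c \<longleftrightarrow> True \<in> set c \<and> False \<in> set c"
proof -
  have "set c \<subseteq> {True} \<longleftrightarrow> False \<notin> set c" "set c \<subseteq> {False} \<longleftrightarrow> True \<notin> set c"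
    by (induction c) auto
  moreover have "const_word c \<longleftrightarrow> set c \<subseteq> {True} \<or> set c \<subseteq> {False}"
    unfolding const_word_def using ex_bool_eq by metis
  ultimately show ?thesis by blast
qed

text \<open>A word and its tail cannot both start with \<open>[False, True, False]\<close>, which
  gives the escape from red. The summand \<open>k\<close> provides the letters of a red word that
  follow this pattern.\<close>

lemma stepping_up_weak:
  assumes "\<not> partn_lst {..<N} [s, n] k" "k \<ge> 4" "s > k" "n \<ge> 2"
  shows "\<not> partn_lst {..<2 ^ N :: nat} [Suc s, 3 * n + k] (Suc k)"
proof (rule stepping_up[where R = "\<lambda>c. take 3 c = [False, True, False]", OF _ _ assms(1)])
  fix W c assume W: "word_closed W" and c: "c \<in> W" "length c = k" "\<not> const_word c"
  obtain x y z xs where xs: "c = x # y # z # xs" "length xs = k - 3"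
    using c(2) assms(2) by (cases c; cases "tl c"; cases "tl (tl c)") auto
  have "butlast c \<in> W" "tl c \<in> W" "length (butlast c) = k - 1" "length (tl c) = k - 1"
    using word_closed_tl[OF W c(1)] word_closed_butlast[OF W c(1)] c(2) by simp_all
  moreover have "xs \<noteq> []" using xs(2) assms(2) by auto
  moreover have "\<not> const_word (tl c) \<and> take 3 (tl c) \<noteq> [False, True, False]"
    if "const_word (butlast c) \<or> take 3 (butlast c) = [False, True, False]"
  proof (cases "const_word (butlast c)")
    case True
    obtain e where e: "c = butlast c @ [e]" using c(2) assms(2) by (metis append_butlast_last_id list.size(3) not_numeral_le_zero)
    have b: "butlast c = x # y # z # butlast xs" using xs \<open>xs \<noteq> []\<close> by simp
    have "tl c = y # z # butlast xs @ [e]" using e b by (metis append_Cons list.sel(3))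
    moreover have "y = z" using True b unfolding const_word_def by auto
    moreover have "\<not> const_word (tl c)"
    proof
      assume "const_word (tl c)"
      then have "set c \<subseteq> {y}" using True xs(1) b unfolding const_word_def by auto
      then show False using c(3) unfolding const_word_def by blast
    qed
    ultimately show ?thesis by auto
  next
    case False
    then have "take 3 (butlast c) = [False, True, False]" using that by blast
    then have "x = False" "y = True" "z = False" using xs \<open>xs \<noteq> []\<close> by simp_all
    then show ?thesis using xs unfolding const_word_def by auto
  qed
  ultimately show "\<exists>r\<in>W. length r = k - 1 \<and> \<not> const_word r \<and> take 3 r \<noteq> [False, True, False]" by blast
next
  fix W c assume W: "word_closed W" and c: "c \<in> W" "length c = 3 * n + k - 2"
  show "(\<exists>r\<in>W. length r = k - 1 \<and> \<not> const_word r \<and> take 3 r = [False, True, False]) \<or>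
    (\<exists>r\<in>W. length r = n - 1 \<and> const_word r)"
  proof (rule ccontr)
    assume neg: "\<not> ?thesis"
    \<comment> \<open>Three nonconstant blocks supply a descent, an ascent and a descent, hence a run of ascents between
      two descents, which merges into a single ascent.\<close>
    define c1 c2 c3 c4 where "c1 = take (n-1) c" and "c2 = take (n-1) (drop (n-1) c)"
      and "c3 = take (n-1) (drop (2*(n-1)) c)" and "c4 = drop (3*(n-1)) c"
    have c_eq: "c = c1 @ c2 @ c3 @ c4"
    proof -
      have "drop (2*(n-1)) c = c3 @ c4" unfolding c3_def c4_def
        using append_take_drop_id[of "n-1" "drop (2*(n-1)) c"] by (simp add: add.commute)
      moreover have "drop (n-1) c = c2 @ drop (2*(n-1)) c" unfolding c2_def
        using append_take_drop_id[of "n-1" "drop (n-1) c"] by (simp add: mult_2)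
      ultimately show ?thesis unfolding c1_def by (metis append_take_drop_id)
    qed
    have len: "length c1 = n - 1" "length c2 = n - 1" "length c3 = n - 1" "length c4 \<ge> k - 3"
      using c(2) assms by (auto simp: c1_def c2_def c3_def c4_def)
    have mem: "c1 \<in> W" "c2 \<in> W" "c3 \<in> W"
      using word_closed_factor[OF W, of "[]" c1 "c2 @ c3 @ c4"] word_closed_factor[OF W, of c1 c2 "c3 @ c4"]
        word_closed_factor[OF W, of "c1 @ c2" c3 c4] c(1) c_eq by simp_all
    have "\<not> const_word c1" "\<not> const_word c2" "\<not> const_word c3" using neg mem len by blast+
    then have "False \<in> set c1" "True \<in> set c2" "False \<in> set c3" by (simp_all add: not_const_word_iff)
    then obtain p1 q1 p2 q2 p3 q3 where
      p: "c1 = p1 @ False # q1" "c2 = p2 @ True # q2" "c3 = p3 @ False # q3" by (metis split_list)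
    have "False \<in> set (c1 @ p2)" using p by auto
    then obtain u1 u2 where u: "c1 @ p2 = u1 @ False # u2" "False \<notin> set u2" by (metis split_list_last)
    have "False \<in> set (q2 @ p3 @ [False])" by auto
    then obtain v1 v2 where v: "q2 @ p3 @ [False] = v1 @ False # v2" "False \<notin> set v1" by (metis split_list_first)
    have run: "replicate (Suc (length u2 + length v1)) True = u2 @ True # v1"
    proof (rule replicate_eqI[symmetric])
      fix y assume y: "y \<in> set (u2 @ True # v1)"
      show "y = True"
      proof (rule ccontr)
        assume "y \<noteq> True"
        then have "False \<in> set (u2 @ True # v1)" using y by simp
        then show False using u(2) v(2) by simp
      qed
    qed simp
    have "c = (c1 @ p2) @ [True] @ (q2 @ p3 @ [False]) @ q3 @ c4" using c_eq p by simp
    also have "\<dots> = u1 @ [False] @ (u2 @ True # v1) @ [False] @ (v2 @ q3 @ c4)" unfolding u(1) v(1) by simp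
    finally have "u1 @ ([False] @ replicate (Suc (length u2 + length v1)) True @ [False] @ (v2 @ q3 @ c4)) @ [] \<in> W"
      using c(1) run by simp
    then have "[False] @ replicate (Suc (length u2 + length v1)) True @ ([False] @ (v2 @ q3 @ c4)) \<in> W"
      by (rule word_closed_factor[OF W])
    then have "[False] @ replicate 1 True @ ([False] @ (v2 @ q3 @ c4)) \<in> W"
      by (rule word_closed_run[OF W, rotated 2]) auto
    then have m: "[False, True, False] @ (v2 @ q3 @ c4) \<in> W" by simp
    let ?t = "take (k - 4) (v2 @ q3 @ c4)"
    have "([False, True, False] @ ?t) @ drop (k - 4) (v2 @ q3 @ c4) \<in> W"
      using m by (metis append.assoc append_take_drop_id)
    then have "[False, True, False] @ ?t \<in> W" by (rule word_closed_prefix[OF W])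
    moreover have "length ([False, True, False] @ ?t) = k - 1" using len(4) assms(2) by auto
    moreover have "\<not> const_word ([False, True, False] @ ?t)" unfolding const_word_def by auto
    moreover have "take 3 ([False, True, False] @ ?t) = [False, True, False]" by simp
    ultimately show False using neg by blast
  qed
qed (use assms in auto)

section \<open>Random colourings\<close>

text \<open>The counting form of the probability that independent uniform colours fall into
  \<open>C\<close> on all of \<open>Q\<close>.\<close>

lemma card_PiE_restricted:
  fixes T :: nat and C :: "nat set"
  assumes "finite E" "Q \<subseteq> E" "T > 0"
  shows "real (card (PiE E (\<lambda>e. if e \<in> Q then C else {..<T}))) = (real (card C) / T) ^ card Q * T ^ card E"
proof -
  have "card (PiE E (\<lambda>e. if e \<in> Q then C else {..<T})) = (\<Prod>e\<in>E. card (if e \<in> Q then C else {..<T}))"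
    using assms(1) by (rule card_PiE)
  also have "\<dots> = (\<Prod>e\<in>Q. card C) * (\<Prod>e\<in>E - Q. T)"
    using prod.subset_diff[OF assms(2,1), of "\<lambda>e. card (if e \<in> Q then C else {..<T})"]
    by (simp add: mult.commute)
  also have "\<dots> = card C ^ card Q * T ^ (card E - card Q)"
    using assms by (simp add: card_Diff_subset finite_subset)
  finally have "real (card (PiE E (\<lambda>e. if e \<in> Q then C else {..<T}))) = real (card C) ^ card Q * T ^ (card E - card Q)"
    by simp
  moreover have "real T ^ card E = T ^ (card E - card Q) * T ^ card Q"
    using card_mono[OF assms(1,2)] by (simp flip: power_add)
  ultimately show ?thesis using assms(3) by (simp add: power_divide)
qed

lemma one_minus_inverse_power_le_half:
  fixes T :: nat assumes "T > 0" shows "(1 - 1 / real T) ^ T \<le> 1 / 2"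
proof -
  have "(1 - 1 / real T) ^ T \<le> exp (- 1 / real T) ^ T"
    using assms exp_ge_add_one_self[of "- 1 / real T"] by (intro power_mono) auto
  also have "\<dots> = exp (- 1)" using assms by (simp flip: exp_of_nat_mult)
  also have "\<dots> \<le> 1 / 2" using exp_ge_add_one_self[of 1] by (simp add: exp_minus field_simps)
  finally show ?thesis .
qed

text \<open>Each \<open>k\<close>-set is red with probability \<open>2 ^ -t\<close>.\<close>

lemma not_partn_lst_random:
  assumes red: "u * s < t * (s choose k)" and blue: "u * n + 1 < (n choose k) div 2 ^ t"
  shows "\<not> partn_lst {..<2 ^ u :: nat} [s, n] k"
proof
  assume part: "partn_lst {..<2 ^ u :: nat} [s, n] k"
  \<comment> \<open>Counting maps into \<open>T\<close> colours, of which only \<open>0\<close> is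
    read as red, turns probabilities into cardinalities.\<close>
  define T :: nat where "T = 2 ^ t"
  define E where "E = nsets {..<2 ^ u :: nat} k"
  define F where "F = PiE E (\<lambda>_. {..<T})"
  define A where "A C H = PiE E (\<lambda>e. if e \<in> nsets H k then C else {..<T})" for C H
  have T: "T > 0" by (simp add: T_def)
  have fE: "finite E" unfolding E_def by (rule finite_imp_finite_nsets) simp
  have fA: "finite (A C H)" if "C \<subseteq> {..<T}" for C H
    unfolding A_def using fE that by (intro finite_PiE) (auto intro: finite_subset)
  have card_F: "real (card F) = T ^ card E" unfolding F_def using fE by (simp add: card_PiE)
  have card_A: "real (card (A C H)) = (real (card C) / T) ^ (h choose k) * card F"
    if "H \<in> nsets {..<2 ^ u} h" for C H h
  proof -
    have "nsets H k \<subseteq> E" using that by (auto simp: E_def nsets_def)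
    moreover have "card (nsets H k) = card H choose k" by simp
    then have "card (nsets H k) = h choose k" using that by (simp add: nsets_def)
    ultimately show ?thesis unfolding A_def card_F using card_PiE_restricted[OF fE _ T] by simp
  qed
  have card_N: "card (nsets {..<2 ^ u :: nat} h) \<le> 2 ^ (u * h)" for h
  proof -
    have "card (nsets {..<2 ^ u :: nat} h) = (2 ^ u) choose h" by simp
    also have "\<dots> \<le> 2 ^ (u * h)" using binomial_le_pow2[of "2 ^ u" h]
      by (cases "h \<le> 2 ^ u") (auto simp: power_mult binomial_le_pow binomial_eq_0)
    finally show ?thesis .
  qed
  \<comment> \<open>Every colouring is assumed to have a bad set, so these families exhaust
    \<open>F\<close>; by \<open>p1\<close> and \<open>p2\<close> they make up at most
    \<open>1/2 + 1/4\<close> of it.\<close>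
  have cover: "F \<subseteq> (\<Union>H\<in>nsets {..<2 ^ u} s. A {0} H) \<union> (\<Union>H\<in>nsets {..<2 ^ u} n. A {1..<T} H)"
  proof
    fix f assume f: "f \<in> F"
    define g where "g e = (if f e = 0 then 0 else 1 :: nat)" for e
    have "g \<in> nsets {..<2 ^ u} k \<rightarrow> {..<length [s, n]}" by (auto simp: g_def)
    from bspec[OF part[unfolded partn_lst_def monochromatic_def] this] obtain i H where
      i: "i < length [s, n]" and H: "H \<in> nsets {..<2 ^ u} ([s, n] ! i)" and g: "g ` nsets H k \<subseteq> {i}" by blast
    show "f \<in> (\<Union>H\<in>nsets {..<2 ^ u} s. A {0} H) \<union> (\<Union>H\<in>nsets {..<2 ^ u} n. A {1..<T} H)"
    proof (cases i)
      case 0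
      have "f e = 0" if "e \<in> nsets H k" for e using g that 0 by (auto simp: g_def split: if_splits)
      then have "f \<in> A {0} H" using f unfolding A_def F_def by (auto simp: PiE_iff)
      then show ?thesis using H 0 by auto
    next
      case (Suc j)
      have "f e \<noteq> 0" if "e \<in> nsets H k" for e using g that Suc by (auto simp: g_def split: if_splits)
      then have "f \<in> A {1..<T} H" using f unfolding A_def F_def by (fastforce simp: PiE_iff)
      then show ?thesis using H Suc i by auto
    qed
  qed
  have sum_bound: "real (card (\<Union>H\<in>nsets {..<2 ^ u} h. A C H)) \<le> 2 ^ (u * h) * ((real (card C) / T) ^ (h choose k) * card F)"
    if "C \<subseteq> {..<T}" for C h
  proof -
    have fin: "finite (nsets {..<2 ^ u :: nat} h)" by (rule finite_imp_finite_nsets) simp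
    have "real (card (\<Union>H\<in>nsets {..<2 ^ u} h. A C H)) \<le> real (\<Sum>H\<in>nsets {..<2 ^ u} h. card (A C H))"
      using card_UN_le[OF fin] of_nat_mono by blast
    also have "\<dots> = (\<Sum>H\<in>nsets {..<2 ^ u :: nat} h. (real (card C) / T) ^ (h choose k) * card F)"
      unfolding of_nat_sum by (rule sum.cong[OF refl card_A])
    also have "\<dots> = real (card (nsets {..<2 ^ u :: nat} h)) * ((real (card C) / T) ^ (h choose k) * card F)"
      by simp
    also have "\<dots> \<le> 2 ^ (u * h) * ((real (card C) / T) ^ (h choose k) * card F)"
    proof (rule mult_right_mono)
      show "real (card (nsets {..<2 ^ u :: nat} h)) \<le> 2 ^ (u * h)"
        using card_N[of h] by (metis of_nat_le_iff of_nat_numeral of_nat_power)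
    qed simp
    finally show ?thesis .
  qed
  have p1: "(2::real) ^ (u * s) * (real (card {0::nat}) / T) ^ (s choose k) \<le> 1 / 2"
  proof -
    have "(2::real) ^ (u * s) * 2 \<le> 2 ^ (t * (s choose k))"
      using red power_increasing[of "Suc (u * s)" "t * (s choose k)" "2::real"] by simp
    then show ?thesis by (simp add: T_def power_mult power_divide field_simps)
  qed
  \<comment> \<open>The exponent is rounded down to a multiple of \<open>T\<close>, and each block
    of \<open>T\<close> factors contributes at most one half.\<close>
  have p2: "(2::real) ^ (u * n) * (real (card {1..<T}) / T) ^ (n choose k) \<le> 1 / 4"
  proof -
    define c where "c = (n choose k) div T"
    define x where "x = 1 - 1 / real T"
    have x: "0 \<le> x" "x \<le> 1" using T by (auto simp: x_def)
    have "real (card {1..<T}) / T = x" using T by (simp add: x_def field_simps of_nat_diff)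
    moreover have "x ^ (n choose k) \<le> x ^ (T * c)" using x by (intro power_decreasing) (simp_all add: c_def)
    moreover have "x ^ (T * c) \<le> (1 / 2) ^ c" unfolding power_mult
      using one_minus_inverse_power_le_half[OF T] x by (intro power_mono) (auto simp: x_def)
    moreover have "(1 / 2 :: real) ^ c \<le> (1 / 2) ^ (u * n + 2)"
      using blue by (intro power_decreasing) (auto simp: c_def T_def)
    ultimately have "(real (card {1..<T}) / T) ^ (n choose k) \<le> (1 / 2) ^ (u * n + 2)" by simp
    then have "(2::real) ^ (u * n) * (real (card {1..<T}) / T) ^ (n choose k) \<le> 2 ^ (u * n) * (1 / 2) ^ (u * n + 2)"
      by (intro mult_left_mono) auto
    also have "\<dots> = 1 / 4" by (simp add: power_add power_divide)
    finally show ?thesis .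
  qed
  have fin: "finite (\<Union>H\<in>nsets {..<2 ^ u :: nat} h. A C H)" if "C \<subseteq> {..<T}" for C h
    using fA[OF that] by (intro finite_UN_I finite_imp_finite_nsets) auto
  have C: "{0} \<subseteq> {..<T}" "{1..<T} \<subseteq> {..<T}" using T by auto
  have "card F \<le> card ((\<Union>H\<in>nsets {..<2 ^ u} s. A {0} H) \<union> (\<Union>H\<in>nsets {..<2 ^ u} n. A {1..<T} H))"
    using fin[OF C(1)] fin[OF C(2)] by (intro card_mono cover finite_UnI)
  also have "\<dots> \<le> card (\<Union>H\<in>nsets {..<2 ^ u} s. A {0} H) + card (\<Union>H\<in>nsets {..<2 ^ u} n. A {1..<T} H)"
    by (rule card_Un_le)
  finally have "real (card F) \<le> card (\<Union>H\<in>nsets {..<2 ^ u} s. A {0} H) + card (\<Union>H\<in>nsets {..<2 ^ u} n. A {1..<T} H)"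
    by (metis of_nat_add of_nat_le_iff)
  also have "\<dots> \<le> (2 ^ (u * s) * (real (card {0::nat}) / T) ^ (s choose k)) * card F
      + (2 ^ (u * n) * (real (card {1..<T}) / T) ^ (n choose k)) * card F"
    using sum_bound[OF C(1), of s] sum_bound[OF C(2), of n] by (simp add: mult.assoc)
  also have "\<dots> \<le> 1 / 2 * card F + 1 / 4 * card F"
    using p1 p2 by (intro add_mono mult_right_mono) auto
  finally have "real (card F) \<le> 0" by simp
  moreover have "real (T ^ card E) > 0" using T by simp
  ultimately show False using card_F by linarith
qed

section \<open>Colourings of triples and quadruples\<close>

text \<open>Colour a quadruple red iff the colour of its first triple is smaller than that of its last triple;
  along a red tight path the colours increase, and on a blue set they decrease from left to right.\<close>

lemma not_partn_lst_increase:
  assumes "\<not> partn_lst {..<N :: nat} (replicate q m) 3" "m \<ge> 3" "q > 0"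
  shows "\<not> partn_lst {..<N} [q + 3, q * m] 4"
proof
  assume part: "partn_lst {..<N} [q + 3, q * m] 4"
  obtain f where f: "f \<in> nsets {..<N} 3 \<rightarrow> {..<q}"
    and nf: "\<And>i H. i < q \<Longrightarrow> H \<in> nsets {..<N} m \<Longrightarrow> \<not> f ` nsets H 3 \<subseteq> {i}"
    using assms(1) unfolding partn_lst_def monochromatic_def by auto
  define g where "g X = (let xs = sorted_list_of_set X in
    if f (set (take 3 xs)) < f (set (drop 1 xs)) then 0 else 1 :: nat)" for X :: "nat set"
  have g4: "g {a, b, c, d} = (if f {a, b, c} < f {b, c, d} then 0 else 1)"
    if "a < b" "b < c" "c < d" for a b c d
  proof -
    have "sorted_list_of_set {a, b, c, d} = [a, b, c, d]" using that by (simp add: insort_is_Cons)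
    then show ?thesis by (simp add: g_def insert_commute)
  qed
  have "g \<in> nsets {..<N} 4 \<rightarrow> {..<length [q + 3, q * m]}" by (auto simp: g_def Let_def)
  from bspec[OF part[unfolded partn_lst_def monochromatic_def] this] obtain i H where
    i: "i < length [q + 3, q * m]" and H: "H \<in> nsets {..<N} ([q + 3, q * m] ! i)" and gH: "g ` nsets H 4 \<subseteq> {i}"
    by blast
  have fin: "finite H" "H \<subseteq> {..<N}" "card H = [q + 3, q * m] ! i" using H by (auto simp: nsets_def)
  have colour: "f {a, b, c} < f {b, c, d} \<longleftrightarrow> i = 0" if "a \<in> H" "b \<in> H" "c \<in> H" "d \<in> H" "a < b" "b < c" "c < d" for a b c d
  proof -
    have "{a, b, c, d} \<in> nsets H 4" using that by (auto simp: nsets_def)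
    then have "g {a, b, c, d} = i" using gH by blast
    then show ?thesis using g4[OF that(5-7)] by (auto split: if_splits)
  qed
  have fq: "f {a, b, c} < q" if "a \<in> H" "b \<in> H" "c \<in> H" "a < b" "b < c" for a b c
  proof -
    have "{a, b, c} \<in> nsets {..<N} 3" using that fin by (auto simp: nsets_def)
    then show ?thesis using f by auto
  qed
  define h where "h = (!) (sorted_list_of_set H)"
  have hH: "h j \<in> H" if "j < card H" for j
    using that nth_mem[of j "sorted_list_of_set H"] fin(1) by (simp add: h_def)
  have h_less: "h j < h k" if "j < k" "k < card H" for j k
    using sorted_wrt_nth_less[of "(<)" "sorted_list_of_set H" j k] that by (simp add: h_def)
  show False
  proof (cases i)
    case 0
    then have card: "card H = q + 3" using fin by simp
    \<comment> \<open>Consecutive triples have strictly increasing colours, so the one starting at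
      place \<open>q\<close> would need a colour of at least \<open>q\<close>.\<close>
    have "j \<le> q \<Longrightarrow> f {h j, h (j + 1), h (j + 2)} \<ge> j" for j
    proof (induction j)
      case (Suc j)
      have "f {h j, h (j + 1), h (j + 2)} < f {h (j + 1), h (j + 2), h (j + 3)}"
        using colour[of "h j" "h (j + 1)" "h (j + 2)" "h (j + 3)"] Suc.prems card 0 by (simp add: hH h_less)
      then show ?case using Suc by (simp add: eval_nat_numeral)
    qed simp
    from this[of q] show False using fq[of "h q" "h (q + 1)" "h (q + 2)"] card by (simp add: hH h_less)
  next
    case (Suc i')
    then have card: "card H = q * m" using fin i by simp
    have le: "f {b, c, d} \<le> f {a, b, c}" if "a \<in> H" "b \<in> H" "c \<in> H" "d \<in> H" "a < b" "b < c" "c < d" for a b c d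
      using colour[OF that] Suc by simp
    have before: "f {a', b', c'} \<le> f {a, b, c}"
      if "a \<in> H" "b \<in> H" "c \<in> H" "a' \<in> H" "b' \<in> H" "c' \<in> H" "a < b" "b < c" "c < a'" "a' < b'" "b' < c'" for a b c a' b' c'
    proof -
      have "f {b, c, a'} \<le> f {a, b, c}" "f {c, a', b'} \<le> f {b, c, a'}" "f {a', b', c'} \<le> f {c, a', b'}"
        using that by (auto intro!: le)
      then show ?thesis by linarith
    qed
    \<comment> \<open>The blue set is cut into \<open>q\<close> consecutive blocks of
      \<open>m\<close> vertices, none of which is monochromatic under \<open>f\<close>.\<close>
    define B where "B j = h ` {j * m..<j * m + m}" for j
    have B_sub: "B j \<subseteq> H" and B_nsets: "B j \<in> nsets {..<N} m" if "j < q" for j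
    proof -
      have "j * m + m \<le> card H" using that mult_le_mono1[of "Suc j" q m] card by simp
      then have lt: "i < card H" if "i \<in> {j * m..<j * m + m}" for i using that by auto
      then show "B j \<subseteq> H" using hH by (auto simp: B_def)
      moreover have "inj_on h {j * m..<j * m + m}"
        using lt h_less by (intro inj_onI) (metis linorder_neqE_nat nat_less_le)
      then have "card (B j) = m" by (simp add: B_def card_image)
      ultimately show "B j \<in> nsets {..<N} m" using fin(2) by (auto simp: nsets_def B_def)
    qed
    have B_less: "x < y" if "x \<in> B j" "y \<in> B (Suc j)" "Suc j < q" for x y j
    proof -
      obtain u v where uv: "x = h u" "y = h v" "u < j * m + m" "Suc j * m \<le> v" "v < Suc j * m + m"
        using \<open>x \<in> B j\<close> \<open>y \<in> B (Suc j)\<close> by (auto simp: B_def)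
      moreover have "Suc j * m + m \<le> card H" using that(3) mult_le_mono1[of "Suc (Suc j)" q m] card by simp
      ultimately show ?thesis using h_less[of u v] by simp
    qed
    have triple: "\<exists>a b c. S = {a, b, c} \<and> a < b \<and> b < c" if "S \<in> nsets (B j) 3" for S j
    proof -
      define xs where "xs = sorted_list_of_set S"
      have xs: "length xs = 3" "S = set xs" "sorted_wrt (<) xs"
        using that by (simp_all add: nsets_def xs_def)
      then obtain a b c where "xs = [a, b, c]" by (auto simp: length_Suc_conv numeral_3_eq_3)
      then show ?thesis using xs(2,3) by auto
    qed
    have two: "\<exists>S\<in>nsets (B j) 3. \<exists>S'\<in>nsets (B j) 3. f S < f S'" if "j < q" for j
    proof -
      have fS: "f S < q" if "S \<in> nsets (B j) 3" for S
      proof -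
        have "S \<in> nsets {..<N} 3" using that B_sub[OF \<open>j < q\<close>] fin(2) by (auto simp: nsets_def)
        then show ?thesis using f by auto
      qed
      have "nsets (B j) 3 \<noteq> {}" using B_nsets[OF that] assms(2) nsets_eq_empty_iff[of "B j" 3]
        by (auto simp: nsets_def)
      then obtain S0 where S0: "S0 \<in> nsets (B j) 3" by blast
      then have "\<not> f ` nsets (B j) 3 \<subseteq> {f S0}" using nf[OF fS B_nsets[OF that]] by blast
      then obtain S1 where "S1 \<in> nsets (B j) 3" "f S1 \<noteq> f S0" by blast
      then show ?thesis using S0 by (metis linorder_neqE_nat)
    qed
    \<comment> \<open>Each block has two colours, and the larger is at most the colour found in the
      block before. The smaller one thus drops by at least one per block, and after \<open>q\<close>
      blocks no colour is left.\<close>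
    have "j < q \<Longrightarrow> \<exists>S\<in>nsets (B j) 3. f S + j + 1 < q" for j
    proof (induction j)
      case 0
      obtain S S' where S: "S \<in> nsets (B 0) 3" "S' \<in> nsets (B 0) 3" "f S < f S'" using two[OF 0] by blast
      have "S' \<in> nsets {..<N} 3" using S(2) B_sub[OF 0] fin(2) by (auto simp: nsets_def)
      then have "f S' < q" using f by auto
      then show ?case using S by (intro bexI[of _ S]) auto
    next
      case (Suc j)
      obtain S0 where S0: "S0 \<in> nsets (B j) 3" "f S0 + j + 1 < q" using Suc by auto
      obtain S S' where S: "S \<in> nsets (B (Suc j)) 3" "S' \<in> nsets (B (Suc j)) 3" "f S < f S'"
        using two[OF Suc.prems] by blast
      obtain a b c a' b' c' where abc: "S0 = {a, b, c}" "a < b" "b < c" "S' = {a', b', c'}" "a' < b'" "b' < c'"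
        using triple[OF S0(1)] triple[OF S(2)] by blast
      have mem: "a \<in> B j" "b \<in> B j" "c \<in> B j" "a' \<in> B (Suc j)" "b' \<in> B (Suc j)" "c' \<in> B (Suc j)"
        using S0(1) S(2) abc by (auto simp: nsets_def)
      have "f S' \<le> f S0" unfolding abc(1,4)
        by (rule before) (use mem B_sub[of j] B_sub[of "Suc j"] Suc.prems abc B_less in auto)
      then show ?case using S S0 by (intro bexI[of _ S]) auto
    qed
    from this[of "q - 1"] show False using assms(3) by auto
  qed
qed

section \<open>From graphs to triples\<close>

lemma const_word_short: "length c < 2 \<Longrightarrow> const_word c"
  unfolding const_word_def by (cases c; cases "tl c") auto

text \<open>A nonconstant word would contain a nonconstant word of two letters, and each of these
  letters is the word of a triple.\<close>

lemma monotone_of_triples: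
  assumes fin: "finite X" and tri: "\<And>Y. Y \<in> nsets X 3 \<Longrightarrow> ascents (deltas (sorted_list_of_set Y)) = [x]"
  shows "monotone_list (deltas (sorted_list_of_set X))"
proof -
  let ?d = "deltas (sorted_list_of_set X)"
  have d: "?d \<in> delta_lists X" using fin by (rule deltas_of_set_mem)
  have "const_word (ascents ?d)"
  proof (rule ccontr)
    assume nc: "\<not> const_word (ascents ?d)"
    have W: "word_closed (ascents ` delta_lists X)" by (rule word_closed_ascents)
    have "length (ascents ?d) \<ge> 2"
      using nc const_word_short linorder_not_le by blast
    then obtain r where r: "r \<in> ascents ` delta_lists X" "length r = 2" "\<not> const_word r"
      using word_closed_nonconst_factor[OF W order_refl imageI[OF d] nc] by blast
    obtain y z where yz: "r = [y, z]" by (rule length_2_obtain[OF r(2)])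
    have eq: "y = x" if y: "[y] \<in> ascents ` delta_lists X" for y
    proof -
      obtain e where e: "[y] = ascents e" "e \<in> delta_lists X" using y by blast
      have "length (ascents e) = 1" using e(1) by (metis length_Cons list.size(3) One_nat_def)
      then have len: "length e = 2" by simp
      then have "e \<noteq> []" by auto
      then obtain Y where Y: "Y \<subseteq> X" "finite Y" "card Y = Suc (length e)" "deltas (sorted_list_of_set Y) = e"
        by (rule delta_list_of_set[OF e(2)])
      then have "Y \<in> nsets X 3" using len by (simp add: nsets_def)
      then show ?thesis using tri[of Y] Y(4) e(1) by simp
    qed
    have "[y] \<in> ascents ` delta_lists X" "[z] \<in> ascents ` delta_lists X"
      using word_closed_butlast[OF W r(1)] word_closed_tl[OF W r(1)] yz by simp_all
    then have "y = z" using eq[of y] eq[of z] by blast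
    then show False using r(3) yz unfolding const_word_def by auto
  qed
  then show ?thesis using const_word_ascents[OF d] by blast
qed

lemma deltas_triple:
  assumes "Y \<in> nsets {..<2 ^ M :: nat} 3"
  obtains a b where "deltas (sorted_list_of_set Y) = [a, b]" "{a, b} \<in> nsets {..<M} 2" "a \<noteq> b"
proof -
  let ?d = "deltas (sorted_list_of_set Y)"
  have Y: "finite Y" "card Y = 3" "Y \<subseteq> {..<2 ^ M}" using assms by (auto simp: nsets_def)
  then have "length ?d = 2" by simp
  then obtain a b where ab: "?d = [a, b]" by (rule length_2_obtain)
  have "a \<noteq> b" using delta_lists_adjacent[of "[]" a b "[]" Y] deltas_of_set_mem[OF Y(1)] ab by simp
  moreover have "set ?d \<subseteq> {..<M}" using delta_lists_bounded[OF deltas_of_set_mem[OF Y(1)] Y(3)] .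
  ultimately show ?thesis using that[OF ab] ab by (auto simp: nsets_def)
qed

lemma levels_of_monotone:
  assumes X: "X \<in> nsets {..<2 ^ M :: nat} (Suc m)" and mono: "monotone_list (deltas (sorted_list_of_set X))"
  shows "set (deltas (sorted_list_of_set X)) \<in> nsets {..<M} m"
    and "e \<in> nsets (set (deltas (sorted_list_of_set X))) 2 \<Longrightarrow>
      \<exists>Y\<in>nsets X 3. set (deltas (sorted_list_of_set Y)) = e"
proof -
  let ?d = "deltas (sorted_list_of_set X)"
  have fin: "finite X" "card X = Suc m" "X \<subseteq> {..<2 ^ M}" using X by (auto simp: nsets_def)
  have d: "?d \<in> delta_lists X" using fin(1) by (rule deltas_of_set_mem)
  show "set ?d \<in> nsets {..<M} m"
    using delta_lists_bounded[OF d fin(3)] distinct_card[OF monotone_list_distinct[OF mono]] fin(2)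
    by (simp add: nsets_def)
  assume e: "e \<in> nsets (set ?d) 2"
  then have "e \<subseteq> set ?d" "e \<noteq> {}" by (auto simp: nsets_def)
  then obtain Y where "Y \<subseteq> X" "finite Y" "card Y = Suc (card e)"
    "monotone_list (deltas (sorted_list_of_set Y))" "set (deltas (sorted_list_of_set Y)) = e"
    by (rule monotone_subset_of_set[OF d mono])
  then show "\<exists>Y\<in>nsets X 3. set (deltas (sorted_list_of_set Y)) = e"
    using e by (intro bexI[of _ Y]) (auto simp: nsets_def)
qed

text \<open>A triple has two levels; its colour records the graph colour of this pair and whether
  the pair ascends. A monochromatic set of \<open>m + 1\<close> vertices then has \<open>m\<close>
  monotone levels that are homogeneous in the graph.\<close>

lemma not_partn_lst_four_colours:
  assumes "\<not> partn_lst {..<M :: nat} [m, m] 2"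
  shows "\<not> partn_lst {..<2 ^ M :: nat} (replicate 4 (Suc m)) 3"
proof
  assume part: "partn_lst {..<2 ^ M :: nat} (replicate 4 (Suc m)) 3"
  obtain f :: "nat set \<Rightarrow> nat" where f: "f \<in> nsets {..<M} 2 \<rightarrow> {..<2}"
    and nf: "\<And>H. H \<in> nsets {..<M} m \<Longrightarrow> \<not> f ` nsets H 2 \<subseteq> {0}"
      "\<And>H. H \<in> nsets {..<M} m \<Longrightarrow> \<not> f ` nsets H 2 \<subseteq> {1}"
    by (rule not_partn_lst_2E[OF assms], rule that; blast)
  define D where "D Y = deltas (sorted_list_of_set Y)" for Y :: "nat set"
  define g where "g Y = f (set (D Y)) + (if hd (ascents (D Y)) then 2 else 0)" for Y
  have tri: "ascents (D Y) = [hd (ascents (D Y))]" "f (set (D Y)) < 2" if "Y \<in> nsets {..<2 ^ M} 3" for Y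
    by (rule deltas_triple[OF that]; use f in \<open>auto simp: D_def\<close>)+
  have "g \<in> nsets {..<2 ^ M} 3 \<rightarrow> {..<length (replicate 4 (Suc m))}" using tri(2) by (fastforce simp: g_def)
  from bspec[OF part[unfolded partn_lst_def monochromatic_def] this] obtain i H where
    i: "i < 4" and H: "H \<in> nsets {..<2 ^ M} (Suc m)" and gH: "g ` nsets H 3 \<subseteq> {i}" by auto
  have sub: "Y \<in> nsets {..<2 ^ M} 3" if "Y \<in> nsets H 3" for Y using that H by (auto simp: nsets_def)
  have eq: "hd (ascents (D Y)) \<longleftrightarrow> i \<ge> 2" "f (set (D Y)) = i mod 2" if "Y \<in> nsets H 3" for Y
  proof -
    have "g Y = i" using gH that by blast
    then show "hd (ascents (D Y)) \<longleftrightarrow> i \<ge> 2" "f (set (D Y)) = i mod 2"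
      using tri(2)[OF sub[OF that]] by (auto simp: g_def split: if_splits)
  qed
  have mono: "monotone_list (deltas (sorted_list_of_set H))"
    using H tri(1)[OF sub] eq(1) by (intro monotone_of_triples[of _ "i \<ge> 2"]) (auto simp: nsets_def D_def)
  have "f ` nsets (set (D H)) 2 \<subseteq> {i mod 2}"
    using levels_of_monotone(2)[OF H mono] eq(2) by (fastforce simp: D_def)
  moreover have "i mod 2 = 0 \<or> i mod 2 = 1" by auto
  ultimately show False using nf[OF levels_of_monotone(1)[OF H mono]] by (auto simp: D_def)
qed

lemma split_level_less_iff:
  assumes "x \<noteq> y" shows "split_level x y < L \<longleftrightarrow> x div 2 ^ L = y div 2 ^ L"
proof (cases L)
  case (Suc i)
  then show ?thesis using split_level_le_iff[of x y i] by (simp add: less_Suc_eq_le)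
qed (use assms in simp)

text \<open>Follow the larger half of the binary tree of \<open>X\<close> from the root downwards, and take the levels of the
  branchings; any two of them are the levels of a triple.\<close>

lemma branching_levels:
  "finite X \<Longrightarrow> card X > 2 ^ r \<Longrightarrow> \<exists>S. finite S \<and> card S = Suc r \<and>
     (\<forall>l\<in>S. \<exists>u\<in>X. \<exists>v\<in>X. u < v \<and> l = split_level u v) \<and>
     (\<forall>e\<in>nsets S 2. \<exists>Y\<in>nsets X 3. set (deltas (sorted_list_of_set Y)) = e)"
proof (induction r arbitrary: X)
  case 0
  then obtain u v where "u \<in> X" "v \<in> X" "u \<noteq> v" using card_le_Suc0_iff_eq[of X] by auto
  then obtain u v where "u \<in> X" "v \<in> X" "u < v" by (metis linorder_neqE_nat)
  moreover have "nsets {split_level u v} 2 = {}" by (simp add: nsets_eq_empty_iff)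
  ultimately show ?case by (intro exI[of _ "{split_level u v}"]) auto
next
  case (Suc r)
  define u v L where "u = Min X" and "v = Max X" and "L = split_level u v"
  have ne: "X \<noteq> {}" using Suc.prems by auto
  have uv: "u \<in> X" "v \<in> X" and bd: "\<And>x. x \<in> X \<Longrightarrow> u \<le> x \<and> x \<le> v"
    using Suc.prems(1) ne by (auto simp: u_def v_def)
  have "u \<noteq> v"
  proof
    assume "u = v"
    then have "X \<subseteq> {u}" using bd by fastforce
    then have "card X \<le> 1" using card_mono[of "{u}" X] by simp
    then show False using Suc.prems(2) one_le_power[of "2::nat" "Suc r"] by linarith
  qed
  \<comment> \<open>The two subtrees below the topmost branching of \<open>X\<close>, which is at
    level \<open>L\<close>.\<close>
  define P Q where "P = {x \<in> X. x div 2 ^ L = u div 2 ^ L}" and "Q = X - P"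
  have half: "(x div 2 ^ L) div 2 = (u div 2 ^ L) div 2" if "x \<in> X" for x
  proof -
    have "split_level u x \<le> L" using bd[OF that] split_level_max[of u x v] by (simp add: L_def)
    then have "u div 2 ^ Suc L = x div 2 ^ Suc L" by (simp only: split_level_le_iff)
    then show ?thesis by (simp only: power_Suc2 div_mult2_eq)
  qed
  have cross: "x < y" "split_level x y = L" if "x \<in> P" "y \<in> Q" for x y
  proof -
    have xy: "x \<in> X" "y \<in> X" "x div 2 ^ L = u div 2 ^ L" "y div 2 ^ L \<noteq> u div 2 ^ L"
      using that by (auto simp: P_def Q_def)
    have "u div 2 ^ L \<le> y div 2 ^ L" using bd[OF xy(2)] by (simp add: div_le_mono)
    then have lt: "x div 2 ^ L < y div 2 ^ L" using xy by simp
    then show "x < y" by (metis div_le_mono leD leI)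
    moreover have "(x div 2 ^ L) div 2 = (y div 2 ^ L) div 2" using half xy by simp
    then have "split_level x y \<le> L" unfolding split_level_le_iff by (simp only: power_Suc2 div_mult2_eq)
    moreover have "\<not> split_level x y < L" using split_level_less_iff[of x y L] \<open>x < y\<close> lt by simp
    ultimately show "split_level x y = L" by simp
  qed
  have inner: "split_level x y < L" if "x \<in> Z" "y \<in> Z" "x \<noteq> y" "Z = P \<or> Z = Q" for x y Z
  proof -
    have "x div 2 ^ L = y div 2 ^ L"
    proof (cases "Z = P")
      case False
      have "a = b" if "a div 2 = c div 2" "b div 2 = c div 2" "a \<noteq> c" "b \<noteq> c" for a b c :: nat
        using that div_mult_mod_eq[of a 2] div_mult_mod_eq[of b 2] div_mult_mod_eq[of c 2]
          mod_less_divisor[of 2 a] mod_less_divisor[of 2 b] mod_less_divisor[of 2 c] by linarith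
      from this[of "x div 2 ^ L" "u div 2 ^ L" "y div 2 ^ L"] show ?thesis
        using that False half by (auto simp: P_def Q_def)
    qed (use that in \<open>auto simp: P_def\<close>)
    then show ?thesis using split_level_less_iff[OF that(3)] by simp
  qed
  have "u \<in> P" using uv by (simp add: P_def)
  moreover have "v \<in> Q" using uv split_level_less_iff[OF \<open>u \<noteq> v\<close>, of L] by (auto simp: P_def Q_def L_def)
  moreover have "card P + card Q = card X" using Suc.prems(1)
    unfolding Q_def by (subst card_Diff_subset) (auto simp: P_def card_mono)
  then have "card P > 2 ^ r \<or> card Q > 2 ^ r" using Suc.prems(2) by auto
  \<comment> \<open>The larger subtree \<open>Z\<close> is kept with one vertex \<open>z\<close> of
    the other. Two vertices of \<open>Z\<close> that branch at level \<open>l\<close> form with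
    \<open>z\<close> a triple of levels \<open>L\<close> and \<open>l\<close>.\<close>
  ultimately obtain Z z where Z: "Z = P \<and> z \<in> Q \<or> Z = Q \<and> z \<in> P" "card Z > 2 ^ r" by blast
  have ZX: "Z \<subseteq> X" "z \<in> X" using Z by (auto simp: P_def Q_def)
  then have "finite Z" using Suc.prems(1) finite_subset by blast
  from Suc.IH[OF this Z(2)] obtain S where S: "finite S" "card S = Suc r"
    "\<forall>l\<in>S. \<exists>u\<in>Z. \<exists>v\<in>Z. u < v \<and> l = split_level u v"
    "\<forall>e\<in>nsets S 2. \<exists>Y\<in>nsets Z 3. set (deltas (sorted_list_of_set Y)) = e" by (elim exE conjE)
  have SL: "l < L" if l: "l \<in> S" for l
  proof -
    obtain x y where "x \<in> Z" "y \<in> Z" "x < y" "l = split_level x y" using bspec[OF S(3) l] by blast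
    then show ?thesis using inner[of x Z y] Z(1) by auto
  qed
  have "\<exists>Y\<in>nsets X 3. set (deltas (sorted_list_of_set Y)) = e" if e: "e \<in> nsets (insert L S) 2" for e
  proof (cases "L \<in> e")
    case False
    then have "e \<in> nsets S 2" using e by (auto simp: nsets_def)
    then obtain Y where "Y \<in> nsets Z 3" "set (deltas (sorted_list_of_set Y)) = e" using S(4) by blast
    then show ?thesis using ZX(1) by (intro bexI[of _ Y]) (auto simp: nsets_def)
  next
    case True
    then have "card (e - {L}) = 1" using e by (auto simp: nsets_def)
    then obtain l where "e - {L} = {l}" by (auto simp: card_1_singleton_iff)
    then have l: "e = {L, l}" "l \<in> S" using True e by (auto simp: nsets_def)
    then obtain x y where xy: "x \<in> Z" "y \<in> Z" "x < y" "l = split_level x y" using S(3) by blast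
    have "{x, y, z} \<in> nsets X 3 \<and> set (deltas (sorted_list_of_set {x, y, z})) = e"
    proof (cases "Z = P \<and> z \<in> Q")
      case True
      then have "y < z" "split_level y z = L" using cross xy by auto
      moreover from this have "sorted_list_of_set {x, y, z} = [x, y, z]" using xy by (simp add: insort_is_Cons)
      ultimately show ?thesis using xy ZX l by (auto simp: nsets_def)
    next
      case False
      then have "z < x" "split_level z x = L" using cross xy Z(1) by auto
      moreover from this have "sorted_list_of_set {x, y, z} = [z, x, y]" using xy
        by (simp add: insort_is_Cons insert_commute)
      ultimately show ?thesis using xy ZX l by (auto simp: nsets_def)
    qed
    then show ?thesis by blast
  qed
  moreover have "\<exists>u\<in>X. \<exists>v\<in>X. u < v \<and> l = split_level u v" if "l \<in> insert L S" for l
  proof (cases "l = L")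
    case True
    then show ?thesis using uv bd[OF uv(2)] \<open>u \<noteq> v\<close> by (intro bexI[of _ u] bexI[of _ v]) (auto simp: L_def)
  next
    case False
    then show ?thesis using S(3) that ZX(1) by blast
  qed
  moreover have "card (insert L S) = Suc (Suc r)"
  proof -
    have "L \<notin> S" using SL by blast
    then show ?thesis using S(1,2) by simp
  qed
  ultimately show ?case using S(1) by (intro exI[of _ "insert L S"] conjI ballI) simp_all
qed

text \<open>Triples over graph colour \<open>0\<close> get a single colour for both directions. A
  set of this colour need not be monotone, and \<open>branching_levels\<close> still extracts a
  clique of logarithmic size. The other two colours record the direction and lead to a monotone
  list.\<close>

lemma not_partn_lst_three_colours:
  assumes "\<not> partn_lst {..<M :: nat} [Suc r, m] 2" and p: "p > m" "p > 2 ^ r"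
  shows "\<not> partn_lst {..<2 ^ M :: nat} (replicate 3 p) 3"
proof
  assume part: "partn_lst {..<2 ^ M :: nat} (replicate 3 p) 3"
  obtain f :: "nat set \<Rightarrow> nat" where f: "f \<in> nsets {..<M} 2 \<rightarrow> {..<2}"
    and nf: "\<And>H. H \<in> nsets {..<M} (Suc r) \<Longrightarrow> \<not> f ` nsets H 2 \<subseteq> {0}"
      "\<And>H. H \<in> nsets {..<M} m \<Longrightarrow> \<not> f ` nsets H 2 \<subseteq> {1}"
    by (rule not_partn_lst_2E[OF assms(1)], rule that; blast)
  define D where "D Y = deltas (sorted_list_of_set Y)" for Y :: "nat set"
  define g where "g Y = (if f (set (D Y)) = 0 then 0 else if hd (ascents (D Y)) then 2 else 1 :: nat)" for Y
  have tri: "ascents (D Y) = [hd (ascents (D Y))]" "f (set (D Y)) < 2" if "Y \<in> nsets {..<2 ^ M} 3" for Y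
    by (rule deltas_triple[OF that]; use f in \<open>auto simp: D_def\<close>)+
  have "g \<in> nsets {..<2 ^ M} 3 \<rightarrow> {..<length (replicate 3 p)}" by (auto simp: g_def)
  from bspec[OF part[unfolded partn_lst_def monochromatic_def] this] obtain i H where
    i: "i < 3" and H: "H \<in> nsets {..<2 ^ M} p" and gH: "g ` nsets H 3 \<subseteq> {i}" by auto
  have sub: "Y \<in> nsets {..<2 ^ M} 3" if "Y \<in> nsets H 3" for Y using that H by (auto simp: nsets_def)
  have gY: "g Y = i" if "Y \<in> nsets H 3" for Y using gH that by blast
  show False
  proof (cases "i = 0")
    case True
    have "finite H" "card H > 2 ^ r" using H p by (auto simp: nsets_def)
    from branching_levels[OF this] obtain S where S: "finite S" "card S = Suc r"
      "\<forall>l\<in>S. \<exists>u\<in>H. \<exists>v\<in>H. u < v \<and> l = split_level u v"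
      "\<forall>e\<in>nsets S 2. \<exists>Y\<in>nsets H 3. set (D Y) = e" unfolding D_def by (elim exE conjE)
    have "H \<subseteq> {..<2 ^ M}" using H by (auto simp: nsets_def)
    then have "S \<subseteq> {..<M}" using S(3) split_level_less by fastforce
    then have "S \<in> nsets {..<M} (Suc r)" using S(1,2) by (simp add: nsets_def)
    moreover have "f ` nsets S 2 \<subseteq> {0}"
    proof clarify
      fix e assume "e \<in> nsets S 2"
      then obtain Y where "Y \<in> nsets H 3" "set (D Y) = e" using S(4) by blast
      then show "f e = 0" using gY[of Y] True by (auto simp: g_def split: if_splits)
    qed
    ultimately show False using nf(1) by blast
  next
    case False
    have "Suc m \<le> card H" using p(1) H by (simp add: nsets_def)
    then obtain H' where H': "H' \<subseteq> H" "card H' = Suc m" "finite H'"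
      by (rule obtain_subset_with_card_n)
    have sub': "Y \<in> nsets H 3" if "Y \<in> nsets H' 3" for Y using that H' by (auto simp: nsets_def)
    have H'n: "H' \<in> nsets {..<2 ^ M} (Suc m)" using H H' by (auto simp: nsets_def intro: finite_subset)
    have eq: "hd (ascents (D Y)) \<longleftrightarrow> i = 2" "f (set (D Y)) = 1" if "Y \<in> nsets H' 3" for Y
      using gY[OF sub'[OF that]] tri(2)[OF sub[OF sub'[OF that]]] False
      by (auto simp: g_def split: if_splits)
    have mono: "monotone_list (deltas (sorted_list_of_set H'))"
      using H'n tri(1)[OF sub[OF sub']] eq(1) by (intro monotone_of_triples[of _ "i = 2"]) (auto simp: nsets_def D_def)
    have "f ` nsets (set (D H')) 2 \<subseteq> {1}"
      using levels_of_monotone(2)[OF H'n mono] eq(2) by (fastforce simp: D_def)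
    then show False using nf(2)[OF levels_of_monotone(1)[OF H'n mono]] by (simp add: D_def)
  qed
qed

section \<open>Tower bounds\<close>

text \<open>Colourings live on natural numbers of points while towers are real; the witness
  \<open>N\<close> separates the two, so that stepping up can work with exact powers of two.\<close>

definition ramsey_exceeds :: "nat \<Rightarrow> nat \<Rightarrow> nat \<Rightarrow> real \<Rightarrow> bool" where
  "ramsey_exceeds k s n x \<longleftrightarrow> (\<exists>N::nat. x \<le> real N \<and> \<not> partn_lst {..<N} [s, n] k)"

lemma ramsey_exceedsI: "\<not> partn_lst {..<N :: nat} [s, n] k \<Longrightarrow> x \<le> real N \<Longrightarrow> ramsey_exceeds k s n x"
  unfolding ramsey_exceeds_def by blast

lemma ramsey_number_ge:
  assumes "ramsey_exceeds k s n x" shows "x \<le> real (ramsey_number k s n)"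
proof -
  obtain N :: nat where N: "x \<le> real N" "\<not> partn_lst {..<N} [s, n] k"
    using assms unfolding ramsey_exceeds_def by blast
  have "N \<le> ramsey_number k s n"
  proof (rule ccontr)
    assume "\<not> N \<le> ramsey_number k s n"
    then have "partn_lst {1..N} [s, n] k" using ramsey_number_le_iff[of k s n N] by simp
    then have "partn_lst {..<N} [s, n] k"
      by (rule partn_lst_inj_image[where g = "\<lambda>x. x - 1"]) (auto simp: inj_on_def)
    then show False using N(2) by blast
  qed
  then show ?thesis using N(1) by simp
qed

lemma ramsey_exceeds_mono:
  assumes "ramsey_exceeds k s n x" "s \<le> s'" "n \<le> n'" "x' \<le> x"
  shows "ramsey_exceeds k s' n' x'"
proof -
  obtain N :: nat where N: "x \<le> real N" "\<not> partn_lst {..<N} [s, n] k"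
    using assms(1) unfolding ramsey_exceeds_def by blast
  have "partn_lst {..<N} [s, n] k" if "partn_lst {..<N} [s', n'] k"
    using that by (rule partn_lst_less) (use assms(2,3) in \<open>auto simp: less_Suc_eq\<close>)
  then show ?thesis using N assms(4) by (intro ramsey_exceedsI[of N]) auto
qed

lemma ramsey_exceeds_trivial:
  assumes "s \<ge> k" "n > 0" shows "ramsey_exceeds k s n (real (n - 1))"
proof (rule ramsey_exceedsI[OF _ order_refl])
  show "\<not> partn_lst {..<n - 1} [s, n] k"
  proof
    assume part: "partn_lst {..<n - 1} [s, n] k"
    have "(\<lambda>_. 1) \<in> nsets {..<n - 1} k \<rightarrow> {..<2::nat}" by auto
    then obtain i H where i: "i < length [s, n]" and H: "H \<in> nsets {..<n - 1} ([s, n] ! i)"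
      and f: "(\<lambda>_. 1::nat) ` nsets H k \<subseteq> {i}"
      by (rule partn_lstE[OF part]) auto
    show False
    proof (cases i)
      case 0
      then have "finite H" "card H = s" using H by (auto simp: nsets_def)
      then have "nsets H k \<noteq> {}" using assms(1) by (simp add: nsets_eq_empty_iff)
      then show False using f 0 by auto
    next
      case (Suc j)
      then have "H \<subseteq> {..<n - 1}" "card H = n" using H i by (auto simp: nsets_def)
      then show False using card_mono[of "{..<n - 1}" H] assms(2) by simp
    qed
  qed
qed

lemma twr_step: "i > 0 \<Longrightarrow> twr (Suc i) x = 2 powr twr i x"
  by (cases i) auto

lemma twr_mono: "x \<le> y \<Longrightarrow> twr i x \<le> twr i y"
  by (induction i x rule: twr.induct) auto

lemma continuous_twr: "continuous_on UNIV (twr i)"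
proof (induction i)
  case 0
  have "twr 0 = (\<lambda>x. x)" by auto
  then show ?case by simp
next
  case (Suc i)
  show ?case
  proof (cases i)
    case 0
    then have "twr (Suc i) = (\<lambda>x. x)" by auto
    then show ?thesis by simp
  next
    case (Suc j)
    then have "twr (Suc i) = (\<lambda>x. 2 powr twr i x)" by (auto simp: twr_step)
    then show ?thesis using Suc.IH by (auto intro!: continuous_intros)
  qed
qed

lemma two_powr_le_power: "x \<le> real N \<Longrightarrow> 2 powr x \<le> real (2 ^ N)"
  using powr_mono[of x "real N" 2] by (simp add: powr_realpow)

lemma ramsey_exceeds_weak:
  assumes "ramsey_exceeds k s n (twr h x)" "k \<ge> 4" "s > k" "n \<ge> 2" "h > 0"
  shows "ramsey_exceeds (Suc k) (Suc s) (3 * n + k) (twr (Suc h) x)"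
proof -
  obtain N :: nat where N: "twr h x \<le> real N" "\<not> partn_lst {..<N} [s, n] k"
    using assms(1) unfolding ramsey_exceeds_def by blast
  have "twr (Suc h) x \<le> real (2 ^ N)"
    using two_powr_le_power[OF N(1)] unfolding twr_step[OF assms(5)] .
  then show ?thesis by (rule ramsey_exceedsI[OF stepping_up_weak[OF N(2) assms(2-4)]])
qed

lemma ramsey_exceeds_strong:
  assumes "ramsey_exceeds k s n (twr h x)" "k \<ge> 7" "s > k" "n \<ge> 2 * k" "h > 0"
  shows "ramsey_exceeds (Suc k) (Suc s) (n + 2) (twr (Suc h) x)"
proof -
  obtain N :: nat where N: "twr h x \<le> real N" "\<not> partn_lst {..<N} [s, n] k"
    using assms(1) unfolding ramsey_exceeds_def by blast
  have "twr (Suc h) x \<le> real (2 ^ N)"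
    using two_powr_le_power[OF N(1)] unfolding twr_step[OF assms(5)] .
  then show ?thesis by (rule ramsey_exceedsI[OF stepping_up_strong[OF N(2) assms(2-4)]])
qed

text \<open>The condition \<open>n \<ge> 2 * k\<close> of the sharp step persists because both of
  its sides grow by \<open>2\<close>.\<close>

lemma ramsey_exceeds_strong_iterate:
  assumes "ramsey_exceeds 7 s m (twr h x)" "s > 7" "m \<ge> 14" "h > 0"
  shows "ramsey_exceeds (7 + j) (s + j) (m + 2 * j) (twr (h + j) x)"
proof (induction j)
  case (Suc j)
  show ?case using ramsey_exceeds_strong[OF Suc] assms(2-4) by simp
qed (use assms in simp)

text \<open>The constant takes care of small \<open>n\<close> only if the bound at \<open>n = 3 k + 1\<close> exceeds the tower over \<open>0\<close>.
  The trivial bound \<open>3 k\<close> does so for \<open>k \<le> 6\<close>, but \<^term>\<open>twr 6 0\<close> is already \<open>65536\<close>; this is the reason for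
  the assumption \<open>small_7\<close>.\<close>

locale tower_bound =
  fixes q h :: nat and g :: "nat \<Rightarrow> real"
  assumes q: "q \<ge> 2" and h: "h \<ge> 1" and g_nonneg: "\<And>n. g n \<ge> 0"
    and g_mono: "\<And>m n. 0 < m \<Longrightarrow> m \<le> n \<Longrightarrow> g m \<le> g n"
    and g_scale: "\<exists>d>0. \<forall>m n. 0 < n \<and> n \<le> 6 * m \<and> n \<le> m * m \<longrightarrow> d * g n \<le> g m"
    and base: "\<exists>c>0. \<exists>n0. \<forall>n\<ge>n0. ramsey_exceeds 4 (q + 3) n (twr h (c * g n))"
    and small_7: "\<exists>x. ramsey_exceeds 7 (q + 6) 22 x \<and> twr (h + 3) 0 < x"
    and small_twr: "h \<le> 3"
begin

definition eventual_bound :: "nat \<Rightarrow> bool" where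
  "eventual_bound j \<longleftrightarrow> (\<exists>c>0. \<exists>n0. \<forall>n\<ge>n0. ramsey_exceeds (4 + j) (q + 3 + j) n (twr (h + j) (c * g n)))"

text \<open>The simple step divides \<open>n\<close> by about \<open>3\<close>, which
  \<open>g_scale\<close> absorbs into the constant. The constant shrinks with \<open>j\<close>, so
  the final bound takes it only for \<open>j \<le> 3\<close>.\<close>

lemma eventual_bound: "eventual_bound j"
proof (induction j)
  case 0
  show ?case using base by (simp add: eventual_bound_def)
next
  case (Suc j)
  then obtain c n0 where c: "c > 0"
    "\<And>n. n \<ge> n0 \<Longrightarrow> ramsey_exceeds (4 + j) (q + 3 + j) n (twr (h + j) (c * g n))"
    unfolding eventual_bound_def by blast
  obtain d where d: "d > 0" "\<And>m n. 0 < n \<Longrightarrow> n \<le> 6 * m \<Longrightarrow> n \<le> m * m \<Longrightarrow> d * g n \<le> g m"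
    using g_scale by blast
  show ?case unfolding eventual_bound_def
  proof (intro exI[of _ "c * d"] conjI exI[of _ "3 * n0 + 2 * j + 40"] allI impI)
    show "c * d > 0" using c d by simp
    fix n assume n: "3 * n0 + 2 * j + 40 \<le> n"
    \<comment> \<open>The largest \<open>m\<close> with \<open>3 * m + (4 + j) \<le> n\<close>. The
      threshold on \<open>n\<close> ensures \<open>n \<le> 6 * m\<close>; the logarithm needs
      \<open>n \<le> m * m\<close> instead.\<close>
    define m where "m = (n - (4 + j)) div 3"
    have m: "3 * m + (4 + j) \<le> n" "n0 \<le> m" "12 \<le> m" "n \<le> 6 * m" using n unfolding m_def by linarith+
    have "n \<le> m * m" using m(3,4) mult_le_mono1[of 6 m m] by linarith
    then have "c * (d * g n) \<le> c * g m" using d(2)[of n m] m n c(1) by (intro mult_left_mono) auto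
    then have 1: "twr (Suc (h + j)) (c * d * g n) \<le> twr (Suc (h + j)) (c * g m)"
      by (simp add: mult.assoc twr_mono del: twr.simps)
    have "ramsey_exceeds (Suc (4 + j)) (Suc (q + 3 + j)) (3 * m + (4 + j)) (twr (Suc (h + j)) (c * g m))"
      using c(2)[OF m(2)] q h m(3) by (intro ramsey_exceeds_weak) auto
    from ramsey_exceeds_mono[OF this order_refl m(1) 1]
    show "ramsey_exceeds (4 + Suc j) (q + 3 + Suc j) n (twr (h + Suc j) (c * d * g n))"
      unfolding add_Suc_right .
  qed
qed

text \<open>Below the threshold \<open>n0\<close> the constant is made so small that, by continuity,
  the tower stays below \<open>x\<close>.\<close>

lemma uniform_bound:
  assumes small: "ramsey_exceeds (4 + j) (q + 3 + j) (3 * (4 + j) + 1) x" "twr (h + j) 0 < x"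
  shows "\<exists>c>0. \<forall>n>3 * (4 + j). ramsey_exceeds (4 + j) (q + 3 + j) n (twr (h + j) (c * g n))"
proof -
  obtain c n0 where c: "c > 0"
    "\<And>n. n \<ge> n0 \<Longrightarrow> ramsey_exceeds (4 + j) (q + 3 + j) n (twr (h + j) (c * g n))"
    using eventual_bound[of j] unfolding eventual_bound_def by blast
  have "isCont (twr (h + j)) 0" using continuous_twr[of "h + j"] by (simp add: continuous_on_eq_continuous_at)
  then have "((twr (h + j)) \<longlongrightarrow> twr (h + j) 0) (at 0)" by (simp add: isCont_def)
  then have "\<forall>\<^sub>F y in at 0. twr (h + j) y < x" using small(2) by (rule order_tendstoD(2))
  then obtain e where e: "e > 0" "\<And>y. y \<noteq> 0 \<Longrightarrow> dist y 0 < e \<Longrightarrow> twr (h + j) y < x"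
    unfolding eventually_at by auto
  \<comment> \<open>The summand \<open>1\<close> keeps the denominator positive if \<open>g\<close>
    vanishes.\<close>
  define b where "b = e / (2 * (1 + g (Suc n0)))"
  have gpos: "1 + g (Suc n0) > 0" using g_nonneg[of "Suc n0"] by linarith
  then have b: "b > 0" using e(1) by (simp add: b_def)
  show ?thesis
  proof (intro exI[of _ "min c b"] conjI allI impI)
    show "min c b > 0" using b c(1) by simp
    fix n assume n: "3 * (4 + j) < n"
    show "ramsey_exceeds (4 + j) (q + 3 + j) n (twr (h + j) (min c b * g n))"
    proof (cases "n \<ge> n0")
      case True
      have "min c b * g n \<le> c * g n" using g_nonneg by (intro mult_right_mono) auto
      then show ?thesis using ramsey_exceeds_mono[OF c(2)[OF True]] twr_mono by blast
    next
      case False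
      have "min c b * g n \<le> b * g (Suc n0)"
        using g_mono[of n "Suc n0"] n False g_nonneg[of n] b by (intro mult_mono) auto
      also have "\<dots> \<le> e / 2" using gpos e(1) by (simp add: b_def field_simps)
      finally have "twr (h + j) (min c b * g n) \<le> twr (h + j) (e / 2)" by (rule twr_mono)
      also have "\<dots> \<le> x" using e(2)[of "e / 2"] e(1) by (simp add: dist_real_def)
      finally show ?thesis using ramsey_exceeds_mono[OF small(1)] n by simp
    qed
  qed
qed

lemma small_case:
  assumes "j \<le> 3"
  shows "\<exists>x. ramsey_exceeds (4 + j) (q + 3 + j) (3 * (4 + j) + 1) x \<and> twr (h + j) 0 < x"
proof (cases "j = 3")
  case True
  then show ?thesis using small_7 by (simp add: add.commute del: twr.simps)
next
  case False
  have j: "j \<in> {0, 1, 2}" using assms False by auto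
  have h3: "h \<in> {1, 2, 3}" using h small_twr by auto
  have "ramsey_exceeds (4 + j) (q + 3 + j) (3 * (4 + j) + 1) (real (3 * (4 + j) + 1 - 1))"
    using q by (intro ramsey_exceeds_trivial) auto
  \<comment> \<open>In the worst case \<open>h = 3\<close> the towers are \<open>2\<close>,
    \<open>4\<close>, \<open>16\<close>, against \<open>12\<close>, \<open>15\<close>,
    \<open>18\<close>.\<close>
  moreover have "twr (h + j) 0 < real (3 * (4 + j) + 1 - 1)" using j h3 by (auto simp: eval_nat_numeral)
  ultimately show ?thesis by blast
qed

lemma tower_bound: "\<exists>c>0. \<forall>k n. k \<ge> 4 \<and> n > 3 * k \<longrightarrow> ramsey_exceeds k (q + k - 1) n (twr (h + k - 4) (c * g n))"
proof -
  have "\<forall>j\<in>{..3}. \<exists>c>0. \<forall>n>3 * (4 + j). ramsey_exceeds (4 + j) (q + 3 + j) n (twr (h + j) (c * g n))"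
    using small_case uniform_bound by (metis atMost_iff)
  then obtain c where c: "\<And>j. j \<le> 3 \<Longrightarrow> c j > (0::real)"
    "\<And>j n. j \<le> 3 \<Longrightarrow> n > 3 * (4 + j) \<Longrightarrow> ramsey_exceeds (4 + j) (q + 3 + j) n (twr (h + j) (c j * g n))"
    unfolding bchoice_iff by (metis atMost_iff)
  obtain d where d: "d > 0" "\<And>m n. 0 < n \<Longrightarrow> n \<le> 6 * m \<Longrightarrow> n \<le> m * m \<Longrightarrow> d * g n \<le> g m"
    using g_scale by blast
  \<comment> \<open>One constant for each uniformity from \<open>4\<close> to \<open>7\<close>, and
    \<open>c 3 * d\<close> for all larger ones, where \<open>d\<close> pays for replacing
    \<open>n\<close> by \<open>m\<close>.\<close>
  define b where "b = Min (insert (c 3 * d) (c ` {..3}))"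
  have b: "b > 0" using c(1) d(1) unfolding b_def by auto
  have b_le: "b \<le> c 3 * d" "b \<le> c j" if "j \<le> 3" for j
    unfolding b_def by (rule Min_le; use that in simp)+
  show ?thesis
  proof (intro exI[of _ b] conjI allI impI b)
    fix k n :: nat assume kn: "4 \<le> k \<and> 3 * k < n"
    show "ramsey_exceeds k (q + k - 1) n (twr (h + k - 4) (b * g n))"
    proof (cases "k \<le> 7")
      case True
      define j where "j = k - 4"
      have j: "k = 4 + j" "j \<le> 3" using kn True by (auto simp: j_def)
      have "b * g n \<le> c j * g n" using b_le(2)[OF j(2)] g_nonneg by (intro mult_right_mono) auto
      then show ?thesis using ramsey_exceeds_mono[OF c(2)[OF j(2), of n]] twr_mono kn j(1)
        by (simp del: twr.simps)
    next
      case False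
      \<comment> \<open>What remains after undoing \<open>k - 7\<close> sharp steps at a cost of
        \<open>2\<close> each: \<open>m \<ge> 22\<close> is admissible at uniformity
        \<open>7\<close>, and \<open>n \<le> 3 * m\<close>.\<close>
      define j m where "j = k - 7" and "m = n - 2 * (k - 7)"
      have jm: "k = 7 + j" "n = m + 2 * j" "m \<ge> 22" "n \<le> 3 * m" using kn False by (auto simp: j_def m_def)
      have "n \<le> m * m" using jm(3,4) mult_le_mono1[of 3 m m] by linarith
      then have "d * g n \<le> g m" using d(2)[of n m] jm by simp
      then have "c 3 * (d * g n) \<le> c 3 * g m" using c(1)[of 3] by (intro mult_left_mono) auto
      moreover have "b * g n \<le> c 3 * d * g n" using b_le(1)[of 3] g_nonneg by (intro mult_right_mono) auto
      ultimately have "b * g n \<le> c 3 * g m" by (simp add: mult.assoc)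
      moreover have "h + k - 4 = h + 3 + j" using jm(1) by simp
      ultimately have "twr (h + k - 4) (b * g n) \<le> twr (h + 3 + j) (c 3 * g m)" using twr_mono by simp
      moreover have "ramsey_exceeds (7 + j) (q + 6 + j) (m + 2 * j) (twr (h + 3 + j) (c 3 * g m))"
        using c(2)[of 3 m] jm q by (intro ramsey_exceeds_strong_iterate) (auto simp: add.commute simp del: twr.simps)
      ultimately show ?thesis using jm by (auto elim: ramsey_exceeds_mono simp del: twr.simps)
    qed
  qed
qed

end

section \<open>Base cases from random colourings\<close>

lemma two_times_choose_two: "2 * (m choose 2) = m * (m - 1)"
  unfolding choose_two by (rule dvd_mult_div_cancel) (cases m; auto)

lemma choose_three: "6 * (m choose 3) = m * (m - 1) * (m - 2)"
proof -
  have "3 * (m choose 3) = m * ((m - 1) choose 2)"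
    using Suc_times_binomial[of 2 "m - 1"] by (cases m) (simp_all add: eval_nat_numeral)
  moreover have "2 * ((m - 1) choose 2) = (m - 1) * (m - 2)"
    unfolding two_times_choose_two by (simp add: numeral_2_eq_2)
  ultimately show ?thesis by (metis (no_types, lifting) mult.assoc mult.left_commute mult_2 numeral_Bit0 mult_numeral_left_semiring_numeral)
qed

lemma ramsey_3_diagonal:
  assumes "v \<ge> 1" shows "ramsey_exceeds 4 5 (12 * v + 4) (2 powr (real v)\<^sup>2)"
proof -
  \<comment> \<open>This choice makes \<open>m choose 3\<close> an explicit even number of order
    \<open>v ^ 3\<close>, the order of the exponent \<open>v * v * m\<close> in the union
    bound.\<close>
  define m where "m = 6 * v + 2"
  have "6 * (m choose 3) = 6 * (2 * ((3 * v + 1) * (6 * v + 1) * v))"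
    unfolding choose_three by (simp add: m_def algebra_simps)
  then have ch: "m choose 3 = 2 * ((3 * v + 1) * (6 * v + 1) * v)" by simp
  have "v * v * m + 1 < (3 * v + 1) * (6 * v + 1) * v"
  proof -
    have "1 \<le> v * v" "v * v \<le> v * v * v" using assms by simp_all
    moreover have "v * v * m = 6 * (v * v * v) + 2 * (v * v)"
      "(3 * v + 1) * (6 * v + 1) * v = 18 * (v * v * v) + 9 * (v * v) + v"
      by (simp_all add: m_def algebra_simps)
    ultimately show ?thesis using assms by linarith
  qed
  then have "\<not> partn_lst {..<2 ^ (v * v) :: nat} [m, m] 3"
    by (intro not_partn_lst_random[where t = 1]) (simp_all add: ch)
  then have "\<not> partn_lst {..<2 ^ (v * v) :: nat} (replicate 2 m) 3" by (simp add: numeral_2_eq_2)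
  then have "\<not> partn_lst {..<2 ^ (v * v) :: nat} [2 + 3, 2 * m] 4"
    by (rule not_partn_lst_increase) (use assms in \<open>simp_all add: m_def\<close>)
  then show ?thesis
    by (rule ramsey_exceeds_mono[OF ramsey_exceedsI[OF _ order_refl]])
      (simp_all add: m_def powr_realpow[symmetric] power2_eq_square)
qed

text \<open>A random graph on \<open>2 ^ u\<close> vertices without homogeneous sets of size
  \<open>8 * u\<close> is stepped up once; the passage from triples to quadruples keeps the vertex
  set.\<close>

lemma ramsey_3_four_colours:
  assumes "u \<ge> 1" shows "ramsey_exceeds 4 7 (32 * u + 4) (2 powr (2 powr real u))"
proof -
  have ch: "8 * u choose 2 = 2 * (2 * u * (8 * u - 1))" by (simp add: choose_two)
  have "1 \<le> u * u" "u \<le> u * u" using assms by simp_all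
  moreover have "u * (8 * u) = 8 * (u * u)" "2 * u * (8 * u - 1) = 16 * (u * u) - 2 * u"
    by (simp_all add: diff_mult_distrib2)
  ultimately have "u * (8 * u) + 1 < 2 * u * (8 * u - 1)" using assms by linarith
  moreover have "(8 * u choose 2) div 2 ^ 1 = 2 * u * (8 * u - 1)" unfolding ch by simp
  ultimately have "u * (8 * u) < 1 * (8 * u choose 2)" "u * (8 * u) + 1 < (8 * u choose 2) div 2 ^ 1"
    using ch by linarith+
  then have "\<not> partn_lst {..<2 ^ u :: nat} [8 * u, 8 * u] 2" by (rule not_partn_lst_random)
  then have "\<not> partn_lst {..<2 ^ 2 ^ u :: nat} (replicate 4 (Suc (8 * u))) 3"
    by (rule not_partn_lst_four_colours)
  then have "\<not> partn_lst {..<2 ^ 2 ^ u :: nat} [4 + 3, 4 * Suc (8 * u)] 4"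
    by (rule not_partn_lst_increase) (use assms in simp_all)
  then show ?thesis
    by (rule ramsey_exceeds_mono[OF ramsey_exceedsI[OF _ order_refl]])
      (simp_all add: powr_realpow[symmetric])
qed

lemma square_le_power: "7 \<le> n \<Longrightarrow> n * n \<le> 2 ^ (n - 1)" for n :: nat
proof (induction n rule: dec_induct)
  case (step n)
  have "7 * n \<le> n * n" using step(1) by simp
  then have "Suc n * Suc n \<le> 2 * (n * n)" using step(1) unfolding mult_Suc mult_Suc_right by linarith
  also have "\<dots> \<le> 2 * 2 ^ (n - 1)" using step by simp
  also have "\<dots> = 2 ^ (Suc n - 1)" using step(1) by (cases n) auto
  finally show ?case .
qed simp

text \<open>The clique numbers \<open>2 * t\<close> and \<open>4 ^ t\<close> are balanced so that
  \<open>2 ^ (2 * t - 1)\<close>, the price of the branching argument, stays below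
  \<open>Suc (4 ^ t)\<close>. As \<open>t\<close> is half the binary logarithm of
  \<open>4 ^ t\<close>, the exponent \<open>t * (t - 1)\<close> is quadratic in that
  logarithm.\<close>

lemma ramsey_3_three_colours:
  assumes t: "t \<ge> 7" shows "ramsey_exceeds 4 6 (4 * 4 ^ t) (2 powr (2 powr (real t * (real t - 1))))"
proof -
  define R :: nat where "R = 2 ^ (t - 1)"
  have R: "2 ^ t = 2 * R" using t by (cases t) (auto simp: R_def)
  then have m: "4 ^ t = 4 * (R * R)" by (metis (no_types) mult.assoc mult.commute mult_2_right numeral_Bit0 power_mult_distrib)
  have "t * (t - 1) + 1 \<le> t * t" using t by (cases t) auto
  then have tR: "t * (t - 1) + 1 \<le> R" using square_le_power[OF t] by (simp add: R_def)
  have R1: "R \<ge> 1" by (simp add: R_def)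
  have ch: "(4 ^ t choose 2) div 2 ^ t = R * (4 * (R * R) - 1)"
  proof -
    have "(4 * (R * R) choose 2) = (2 * R) * (R * (4 * (R * R) - 1))" by (simp add: choose_two)
    then show ?thesis unfolding m R using R1 by simp
  qed
  have "t * (t - 1) * 4 ^ t + 1 < (4 ^ t choose 2) div 2 ^ t"
  proof -
    define w where "w = 4 * (R * R)"
    have "(t * (t - 1) + 1) * w \<le> R * w" using tR by (rule mult_le_mono1)
    then have "t * (t - 1) * w + w \<le> R * w" by (simp only: add_mult_distrib mult_1)
    moreover have "4 * R \<le> w" using R1 by (simp add: w_def)
    moreover have "R * (w - 1) = R * w - R" by (simp add: diff_mult_distrib2)
    ultimately have "t * (t - 1) * w + 1 < R * (w - 1)" using R1 by linarith
    then show ?thesis unfolding ch unfolding m w_def .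
  qed
  moreover have "t * (t - 1) * (2 * t) < t * (2 * t choose 2)"
  proof -
    have "2 * t choose 2 = t * (2 * t - 1)" by (simp add: choose_two)
    moreover have "t * (t * (2 * (t - 1))) < t * (t * (2 * t - 1))" using t by auto
    ultimately show ?thesis by (simp add: ac_simps)
  qed
  ultimately have "\<not> partn_lst {..<2 ^ (t * (t - 1)) :: nat} [2 * t, 4 ^ t] 2"
    by (rule not_partn_lst_random[rotated])
  then have "\<not> partn_lst {..<2 ^ (t * (t - 1)) :: nat} [Suc (2 * t - 1), 4 ^ t] 2" using t by simp
  then have "\<not> partn_lst {..<2 ^ 2 ^ (t * (t - 1)) :: nat} (replicate 3 (Suc (4 ^ t))) 3"
  proof (rule not_partn_lst_three_colours)
    have "(2::nat) ^ (2 * t - 1) \<le> 2 ^ (2 * t)" by (rule power_increasing) auto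
    then show "(2::nat) ^ (2 * t - 1) < Suc (4 ^ t)" by (simp add: power_mult)
  qed simp
  then have "\<not> partn_lst {..<2 ^ 2 ^ (t * (t - 1)) :: nat} [3 + 3, 3 * Suc (4 ^ t)] 4"
    by (rule not_partn_lst_increase) (use t self_le_power[of "4::nat" t] in auto)
  then have N: "\<not> partn_lst {..<2 ^ 2 ^ (t * (t - 1)) :: nat} [6, 3 * Suc (4 ^ t)] 4" by simp
  have le: "3 * Suc (4 ^ t) \<le> 4 * 4 ^ t" using self_le_power[of "4::nat" t] t by simp
  have "real t * (real t - 1) = real (t * (t - 1))" using t by (simp add: of_nat_diff)
  then have x: "2 powr (2 powr (real t * (real t - 1))) = real (2 ^ 2 ^ (t * (t - 1)))"
    by (simp add: powr_realpow[symmetric] del: of_nat_mult)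
  from ramsey_exceeds_mono[OF ramsey_exceedsI[OF N order_refl] order_refl le order_refl]
  show ?thesis unfolding x .
qed

text \<open>The vertex number has to exceed \<open>twr 6 0\<close>, which is \<open>2 ^ 16\<close>.
  With \<open>t = 5\<close> the red condition reads \<open>153 < 180\<close> and the blue one
  \<open>375 < 5329\<close>.\<close>

lemma ramsey_7_9: "ramsey_exceeds 7 9 22 (2 ^ 17)"
proof -
  have "fact 7 * fact 15 * (22 choose 7) = (fact 22 :: nat)" using binomial_fact_lemma[of 7 22] by simp
  then have "22 choose 7 = (170544 :: nat)" by (simp add: fact_numeral)
  moreover have "9 choose 7 = (36 :: nat)" by (simp add: binomial_symmetric[of 7] choose_two)
  ultimately have "\<not> partn_lst {..<2 ^ 17 :: nat} [9, 22] 7"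
    by (intro not_partn_lst_random[where t = 5]) simp_all
  then show ?thesis by (rule ramsey_exceedsI) simp
qed

lemma twr_6_0: "twr 6 0 < 2 ^ 17"
proof -
  have "twr 6 0 = 2 powr 16" by (simp add: eval_nat_numeral)
  also have "\<dots> = 2 ^ 16" by (simp flip: powr_numeral)
  finally show ?thesis by simp
qed

section \<open>The three tower bounds\<close>

interpretation four_colours: tower_bound 4 3 "\<lambda>n. real n"
proof
  show "\<exists>d>0. \<forall>m n. 0 < n \<and> n \<le> 6 * m \<and> n \<le> m * m \<longrightarrow> d * real n \<le> real m"
    by (rule exI[of _ "1/6"]) auto
  show "\<exists>c>0. \<exists>n0. \<forall>n\<ge>n0. ramsey_exceeds 4 (4 + 3) n (twr 3 (c * real n))"
  proof (intro exI[of _ "1/72"] conjI exI[of _ 36] allI impI)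
    fix n :: nat assume n: "36 \<le> n"
    \<comment> \<open>\<open>36 * u\<close> covers \<open>32 * u + 4\<close>, and rounding down
      loses at most a factor \<open>2\<close>, whence \<open>72\<close>.\<close>
    define u where "u = n div 36"
    have "u * 36 \<le> n" "n < 36 * u + 36"
      using div_less_iff_less_mult[of 36 n "Suc u"] by (simp_all add: u_def algebra_simps)
    moreover have "u \<ge> 1" using n by (simp add: u_def div_greater_zero_iff Suc_le_eq)
    ultimately have u: "u \<ge> 1" "32 * u + 4 \<le> n" "n \<le> 72 * u" by linarith+
    have "ramsey_exceeds 4 7 n (twr 3 (real u))"
      using ramsey_exceeds_mono[OF ramsey_3_four_colours[OF u(1)] order_refl u(2) order_refl]
      by (simp add: eval_nat_numeral)
    moreover have "twr 3 (1 / 72 * real n) \<le> twr 3 (real u)" using u(3) by (intro twr_mono) simp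
    ultimately show "ramsey_exceeds 4 (4 + 3) n (twr 3 (1 / 72 * real n))"
      using ramsey_exceeds_mono by simp
  qed simp
  show "\<exists>x. ramsey_exceeds 7 (4 + 6) 22 x \<and> twr (3 + 3) 0 < x"
    using ramsey_exceeds_mono[OF ramsey_7_9, of 10 22] twr_6_0 by (intro exI[of _ "2 ^ 17"]) simp
qed auto

interpretation three_colours: tower_bound 3 3 "\<lambda>n. (log 2 (real n))\<^sup>2"
proof
  show "(log 2 (real m))\<^sup>2 \<le> (log 2 (real n))\<^sup>2" if "0 < m" "m \<le> n" for m n
    using that by (intro power_mono) auto
  show "\<exists>d>0. \<forall>m n. 0 < n \<and> n \<le> 6 * m \<and> n \<le> m * m \<longrightarrow> d * (log 2 (real n))\<^sup>2 \<le> (log 2 (real m))\<^sup>2"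
  proof (intro exI[of _ "1/4"] conjI allI impI)
    fix m n :: nat assume mn: "0 < n \<and> n \<le> 6 * m \<and> n \<le> m * m"
    then have m: "m > 0" by auto
    have "real n \<le> real m ^ 2" using mn by (metis of_nat_le_iff of_nat_power power2_eq_square)
    then have "log 2 (real n) \<le> log 2 (real m ^ 2)" using mn by simp
    also have "\<dots> = 2 * log 2 (real m)" using m by (simp add: log_nat_power)
    finally have "(log 2 (real n))\<^sup>2 \<le> (2 * log 2 (real m))\<^sup>2" using mn by (intro power_mono) auto
    then show "1 / 4 * (log 2 (real n))\<^sup>2 \<le> (log 2 (real m))\<^sup>2" by (simp add: power_mult_distrib)
  qed simp
  show "\<exists>c>0. \<exists>n0. \<forall>n\<ge>n0. ramsey_exceeds 4 (3 + 3) n (twr 3 (c * (log 2 (real n))\<^sup>2))"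
  proof (intro exI[of _ "1/18"] conjI exI[of _ "4 ^ 8"] allI impI)
    fix n :: nat assume n: "4 ^ 8 \<le> n"
    define s where "s = nat \<lfloor>log 4 (real n)\<rfloor>"
    have n0: "n > 0" using n by (metis gr0I not_le power_eq_0_iff zero_less_numeral zero_neq_numeral)
    have l0: "log 4 (real n) \<ge> 0" using n0 by simp
    then have s: "real s \<le> log 4 (real n)" "log 4 (real n) < real s + 1"
      by (simp_all add: s_def floor_less_iff)
    have "real (4 ^ 8) \<le> real n" using n by (simp only: of_nat_le_iff)
    then have "8 \<le> log 4 (real n)" using n0 by (simp add: le_log_iff powr_realpow[symmetric])
    then have "s \<ge> 8" unfolding s_def by (simp add: le_nat_iff le_floor_iff)
    \<comment> \<open>The base case needs \<open>4 * 4 ^ t \<le> n\<close>, so one power of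
      \<open>4\<close> is given up; \<open>n \<ge> 4 ^ 8\<close> still leaves
      \<open>t \<ge> 7\<close>.\<close>
    define t where "t = s - 1"
    have t: "t \<ge> 7" "s = Suc t" using \<open>s \<ge> 8\<close> by (auto simp: t_def)
    have "4 powr real s \<le> real n" using s(1) n0 by (simp add: le_log_iff)
    then have "real (4 ^ s) \<le> real n" by (simp add: powr_realpow)
    then have tn: "4 * 4 ^ t \<le> n" unfolding t(2) by (simp only: of_nat_le_iff power_Suc)
    have "log 2 (real n) = 2 * log 4 (real n)"
    proof -
      have "log 4 (real n) = log (2 ^ 2) (real n)" by simp
      also have "\<dots> = log 2 (real n) / 2" using log_base_pow[of 2 2 "real n"] by simp
      finally show ?thesis by simp
    qed
    then have "log 2 (real n) \<le> 2 * (real t + 2)" using s(2) t(2) by simp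
    also have "\<dots> \<le> 3 * real t" using t(1) by simp
    finally have "(log 2 (real n))\<^sup>2 \<le> (3 * real t)\<^sup>2" using n0 by (intro power_mono) auto
    \<comment> \<open>The factor turns \<open>9 * t ^ 2\<close> into \<open>t ^ 2 / 2\<close>, which
      is at most \<open>t * (t - 1)\<close> for \<open>t \<ge> 2\<close>.\<close>
    then have "1 / 18 * (log 2 (real n))\<^sup>2 \<le> real t * real t / 2" by (simp add: power2_eq_square)
    also have "2 * real t \<le> real t * real t" using t(1) by (intro mult_right_mono) auto
    then have "real t * real t / 2 \<le> real t * (real t - 1)" by (simp add: algebra_simps)
    finally have "twr 3 (1 / 18 * (log 2 (real n))\<^sup>2) \<le> twr 3 (real t * (real t - 1))" by (rule twr_mono)
    moreover have "ramsey_exceeds 4 6 n (twr 3 (real t * (real t - 1)))"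
      using ramsey_exceeds_mono[OF ramsey_3_three_colours[OF t(1)] order_refl tn order_refl]
      by (simp add: eval_nat_numeral)
    ultimately show "ramsey_exceeds 4 (3 + 3) n (twr 3 (1 / 18 * (log 2 (real n))\<^sup>2))"
      using ramsey_exceeds_mono by simp
  qed simp
  show "\<exists>x. ramsey_exceeds 7 (3 + 6) 22 x \<and> twr (3 + 3) 0 < x"
    using ramsey_7_9 twr_6_0 by (intro exI[of _ "2 ^ 17"]) simp
qed auto

interpretation two_colours: tower_bound 2 2 "\<lambda>n. (real n)\<^sup>2"
proof
  show "(real m)\<^sup>2 \<le> (real n)\<^sup>2" if "0 < m" "m \<le> n" for m n
    using that by (intro power_mono) auto
  show "\<exists>d>0. \<forall>m n. 0 < n \<and> n \<le> 6 * m \<and> n \<le> m * m \<longrightarrow> d * (real n)\<^sup>2 \<le> (real m)\<^sup>2"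
  proof (intro exI[of _ "1/36"] conjI allI impI)
    fix m n :: nat assume "0 < n \<and> n \<le> 6 * m \<and> n \<le> m * m"
    then have "(real n)\<^sup>2 \<le> (6 * real m)\<^sup>2" by (intro power_mono) auto
    then show "1 / 36 * (real n)\<^sup>2 \<le> (real m)\<^sup>2" by (simp add: power_mult_distrib)
  qed simp
  show "\<exists>c>0. \<exists>n0. \<forall>n\<ge>n0. ramsey_exceeds 4 (2 + 3) n (twr 2 (c * (real n)\<^sup>2))"
  proof (intro exI[of _ "1/1024"] conjI exI[of _ 16] allI impI)
    fix n :: nat assume n: "16 \<le> n"
    \<comment> \<open>Here \<open>12 * v + 4 \<le> 16 * v \<le> n \<le> 32 * v\<close>, and
      \<open>1024\<close> is the square of \<open>32\<close>.\<close>
    define v where "v = n div 16"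
    have "v * 16 \<le> n" "n < 16 * v + 16"
      using div_less_iff_less_mult[of 16 n "Suc v"] by (simp_all add: v_def algebra_simps)
    moreover have "v \<ge> 1" using n by (simp add: v_def div_greater_zero_iff Suc_le_eq)
    ultimately have v: "v \<ge> 1" "12 * v + 4 \<le> n" "n \<le> 32 * v" by linarith+
    have "(real n)\<^sup>2 \<le> (32 * real v)\<^sup>2" using v(3) by (intro power_mono) auto
    then have "1 / 1024 * (real n)\<^sup>2 \<le> (real v)\<^sup>2" by (simp add: power_mult_distrib)
    then have "twr 2 (1 / 1024 * (real n)\<^sup>2) \<le> twr 2 ((real v)\<^sup>2)" by (rule twr_mono)
    moreover have "ramsey_exceeds 4 5 n (twr 2 ((real v)\<^sup>2))"
      using ramsey_exceeds_mono[OF ramsey_3_diagonal[OF v(1)] order_refl v(2) order_refl]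
      by (simp add: eval_nat_numeral)
    ultimately show "ramsey_exceeds 4 (2 + 3) n (twr 2 (1 / 1024 * (real n)\<^sup>2))"
      using ramsey_exceeds_mono by simp
  qed simp
  \<comment> \<open>With \<open>h = 2\<close> the tower over \<open>0\<close> is only
    \<open>16\<close>, so the trivial bound \<open>21\<close> suffices.\<close>
  show "\<exists>x. ramsey_exceeds 7 (2 + 6) 22 x \<and> twr (2 + 3) 0 < x"
    using ramsey_exceeds_trivial[of 7 8 22] by (intro exI[of _ 21]) (simp add: eval_nat_numeral)
qed auto

theorem theorem1:
  shows "\<exists>c::real. c > 0 \<and>
    (\<forall>k n :: nat. k \<ge> 4 \<and> n > 3 * k \<longrightarrow>
       real (ramsey_number k (k + 3) n) \<ge> twr (k - 1) (c * real n) \<and>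
       real (ramsey_number k (k + 2) n) \<ge> twr (k - 1) (c * (log 2 (real n))\<^sup>2) \<and>
       real (ramsey_number k (k + 1) n) \<ge> twr (k - 2) (c * (real n)\<^sup>2))"
proof -
  obtain c4 c3 c2 :: real where pos: "c4 > 0" "c3 > 0" "c2 > 0"
    and 4: "\<And>k n. k \<ge> 4 \<and> n > 3 * k \<Longrightarrow> ramsey_exceeds k (4 + k - 1) n (twr (3 + k - 4) (c4 * real n))"
    and 3: "\<And>k n. k \<ge> 4 \<and> n > 3 * k \<Longrightarrow> ramsey_exceeds k (3 + k - 1) n (twr (3 + k - 4) (c3 * (log 2 (real n))\<^sup>2))"
    and 2: "\<And>k n. k \<ge> 4 \<and> n > 3 * k \<Longrightarrow> ramsey_exceeds k (2 + k - 1) n (twr (2 + k - 4) (c2 * (real n)\<^sup>2))"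
    using four_colours.tower_bound three_colours.tower_bound two_colours.tower_bound by metis
  define c where "c = min c4 (min c3 c2)"
  have scale: "c * x \<le> c4 * x" "c * x \<le> c3 * x" "c * x \<le> c2 * x" if "x \<ge> 0" for x
    using that by (auto simp: c_def intro!: mult_right_mono)
  show ?thesis
  proof (intro exI[of _ c] conjI allI impI)
    show "c > 0" using pos by (simp add: c_def)
    fix k n :: nat assume kn: "4 \<le> k \<and> 3 * k < n"
    have k: "4 + k - 1 = k + 3" "3 + k - 1 = k + 2" "2 + k - 1 = k + 1" "3 + k - 4 = k - 1" "2 + k - 4 = k - 2"
      using kn by simp_all
    show "twr (k - 1) (c * real n) \<le> real (ramsey_number k (k + 3) n)"
      using ramsey_number_ge[OF 4[OF kn]] twr_mono[OF scale(1)[of "real n"]] unfolding k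
      by (meson of_nat_0_le_iff order_trans)
    show "twr (k - 1) (c * (log 2 (real n))\<^sup>2) \<le> real (ramsey_number k (k + 2) n)"
      using ramsey_number_ge[OF 3[OF kn]] twr_mono[OF scale(2)[of "(log 2 (real n))\<^sup>2"]] unfolding k
      by (meson zero_le_power2 order_trans)
    show "twr (k - 2) (c * (real n)\<^sup>2) \<le> real (ramsey_number k (k + 1) n)"
      using ramsey_number_ge[OF 2[OF kn]] twr_mono[OF scale(3)[of "(real n)\<^sup>2"]] unfolding k
      by (meson zero_le_power2 order_trans)
  qed
qed

end
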